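(* Let $2\le k\le n$, $\Omega\subset\mathbb R^n$ a bounded domain with smooth boundary, $\mathcal D=\overline\Omega\times\mathbb R\times\mathbb R^n$, $A,f\in C^1(\mathcal D)$ ($A$ symmetric), $B\in BC^1(\mathcal D)$ skew-symmetric, $0<\delta<1$. Let $u,v\in C^2(\overline\Omega)$ satisfy: (i) $G_k[u](x)\le G_k[v](x)$ for $x\in\Omega$; (ii) $\lambda_u>0$, $\lambda_v>0$; (iii) $D_zA(x,z,p)\ge0$ on $\mathcal D$; (iv) $\mu(B)\le\delta\min(\lambda_u,\lambda_v)$; (v) $\mu(D_zB)\le\beta_1\min(\lambda_u,\lambda_v)$ for some $\beta_1>0$; (vi) $f>0$ on $\mathcal D$; (vii) $\inf_{\mathcal D}[D_zf/f]\ge\frac{k\delta}{1+\delta^2}\beta_1$. Then: (a) if $u\ge v$ on $\partial\Omega$, then $u\ge v$ in $\Omega$; (b) if $u=v$ on $\partial\Omega$, then $\partial u/\partial\nu\ge\partial v/\partial\nu$ on $\partial\Omega$, $\nu$ the unit inner normal.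
   Context: For $R\in\mathbb{R}^{n\times n}$, $S_k(R)=\sigma_k(\lambda(R))$, where $\lambda(R)\in\mathbb{C}^n$ are the eigenvalues of $R$ and $\sigma_k(\lambda)=\sum_{1\le i_1<\dots<i_k\le n}\lambda_{i_1}\cdots\lambda_{i_k}$. For $u\in C^2(\overline\Omega)$: $\omega(x,u)=D^2u-A(x,u,Du)$, $R(x,u)=\omega(x,u)-B(x,u,Du)$, $\lambda_u=\inf_{\overline\Omega}\lambda_{\min}(\omega(x,u))$, and $G_k[u](x)=\log S_k(R(x,u))-\log f(x,u,Du)$. $\mu(B)=\sup_{\mathcal D}\|B\|$, $\mu(D_zB)=\sup_{\mathcal D}\|D_zB\|$ (operator norms). *)

theory Defs
  imports "HOL-Analysis.Analysis"
begin

definition partial_at :: "'n::finite \<Rightarrow> (real^'n \<Rightarrow> real) \<Rightarrow> real^'n \<Rightarrow> real" where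
  "partial_at i g x = frechet_derivative g (at x) (axis i 1)"

fun pderivs :: "'n::finite list \<Rightarrow> (real^'n \<Rightarrow> real) \<Rightarrow> real^'n \<Rightarrow> real" where
  "pderivs [] g = g"
| "pderivs (i # is) g = partial_at i (pderivs is g)"

definition smooth_fun :: "(real^'n::finite \<Rightarrow> real) \<Rightarrow> bool" where
  "smooth_fun g \<longleftrightarrow> (\<forall>is x. pderivs is g differentiable at x)"

definition grad_fun :: "(real^'n::finite \<Rightarrow> real) \<Rightarrow> real^'n \<Rightarrow> real^'n" where
  "grad_fun g x = (\<chi> i. partial_at i g x)"

definition defining_fun :: "(real^'n::finite) set \<Rightarrow> (real^'n \<Rightarrow> real) \<Rightarrow> bool" where
  "defining_fun \<Omega> \<rho> \<longleftrightarrow> smooth_fun \<rho> \<and> \<Omega> = {x. \<rho> x < 0} \<and>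
      (\<forall>x\<in>frontier \<Omega>. \<rho> x = 0 \<and> grad_fun \<rho> x \<noteq> 0)"

definition smooth_bounded_domain :: "(real^'n::finite) set \<Rightarrow> bool" where
  "smooth_bounded_domain \<Omega> \<longleftrightarrow> open \<Omega> \<and> connected \<Omega> \<and> \<Omega> \<noteq> {} \<and> bounded \<Omega> \<and>
      (\<exists>\<rho>. defining_fun \<Omega> \<rho>)"

text \<open>Unit inner normal: minus the normalized gradient of a defining function
  (independent of the chosen defining function).\<close>
definition inner_normal :: "(real^'n::finite) set \<Rightarrow> real^'n \<Rightarrow> real^'n" where
  "inner_normal \<Omega> x = (SOME \<nu>. \<exists>\<rho>. defining_fun \<Omega> \<rho> \<and>
       \<nu> = - (inverse (norm (grad_fun \<rho> x))) *\<^sub>R grad_fun \<rho> x)"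

definition is_C2_derivs :: "(real^'n::finite) set \<Rightarrow> (real^'n \<Rightarrow> real)
     \<Rightarrow> (real^'n \<Rightarrow> real^'n) \<Rightarrow> (real^'n \<Rightarrow> real^'n^'n) \<Rightarrow> bool" where
  "is_C2_derivs S u Du D2u \<longleftrightarrow> continuous_on S Du \<and> continuous_on S D2u \<and>
     (\<forall>x\<in>S. (u has_derivative (\<lambda>h. Du x \<bullet> h)) (at x within S) \<and>
             (Du has_derivative (\<lambda>h. D2u x *v h)) (at x within S))"

definition C2_on :: "(real^'n::finite) set \<Rightarrow> (real^'n \<Rightarrow> real) \<Rightarrow> bool" where
  "C2_on S u \<longleftrightarrow> continuous_on S u \<and> (\<exists>Du D2u. is_C2_derivs S u Du D2u)"

definition Grad :: "(real^'n::finite) set \<Rightarrow> (real^'n \<Rightarrow> real) \<Rightarrow> real^'n \<Rightarrow> real^'n" where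
  "Grad S u = fst (SOME d. is_C2_derivs S u (fst d) (snd d))"

definition Hess :: "(real^'n::finite) set \<Rightarrow> (real^'n \<Rightarrow> real) \<Rightarrow> real^'n \<Rightarrow> real^'n^'n" where
  "Hess S u = snd (SOME d. is_C2_derivs S u (fst d) (snd d))"

definition C1_on :: "'a::real_normed_vector set \<Rightarrow> ('a \<Rightarrow> 'b::real_normed_vector) \<Rightarrow> bool" where
  "C1_on S g \<longleftrightarrow> (\<exists>g'. continuous_on S g' \<and>
      (\<forall>y\<in>S. (g has_derivative blinfun_apply (g' y)) (at y within S)))"

definition BC1_on :: "'a::real_normed_vector set \<Rightarrow> ('a \<Rightarrow> 'b::real_normed_vector) \<Rightarrow> bool" where
  "BC1_on S g \<longleftrightarrow> bounded (g ` S) \<and> (\<exists>g'. continuous_on S g' \<and> bounded (g' ` S) \<and>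
      (\<forall>y\<in>S. (g has_derivative blinfun_apply (g' y)) (at y within S)))"

definition dom_D :: "(real^'n::finite) set \<Rightarrow> ((real^'n) \<times> real \<times> (real^'n)) set" where
  "dom_D \<Omega> = closure \<Omega> \<times> UNIV \<times> UNIV"

definition Dz :: "(real^'n::finite \<Rightarrow> real \<Rightarrow> real^'n \<Rightarrow> 'b::real_normed_vector)
     \<Rightarrow> real^'n \<Rightarrow> real \<Rightarrow> real^'n \<Rightarrow> 'b" where
  "Dz F x z p = vector_derivative (\<lambda>t. F x t p) (at z)"

definition opnorm :: "real^'n::finite^'n \<Rightarrow> real" where
  "opnorm M = onorm (\<lambda>v. M *v v)"

definition psd :: "real^'n::finite^'n \<Rightarrow> bool" where
  "psd M \<longleftrightarrow> (\<forall>\<xi>. \<xi> \<bullet> (M *v \<xi>) \<ge> 0)"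

definition symmetric_mat :: "real^'n::finite^'n \<Rightarrow> bool" where
  "symmetric_mat M \<longleftrightarrow> transpose M = M"

definition skew_mat :: "real^'n::finite^'n \<Rightarrow> bool" where
  "skew_mat M \<longleftrightarrow> transpose M = - M"

text \<open>Smallest (real) eigenvalue; used for symmetric matrices.\<close>
definition lambda_min :: "real^'n::finite^'n \<Rightarrow> real" where
  "lambda_min M = Min {t. \<exists>v. v \<noteq> 0 \<and> M *v v = t *\<^sub>R v}"

definition cmat :: "real^'n::finite^'n \<Rightarrow> complex^'n^'n" where
  "cmat M = (\<chi> i j. complex_of_real (M $ i $ j))"

definition eigvals :: "real^'n::finite^'n \<Rightarrow> 'n \<Rightarrow> complex" where
  "eigvals M = (SOME ev. \<forall>t. det (mat t - cmat M) = (\<Prod>i\<in>UNIV. t - ev i))"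

definition sigma_k :: "nat \<Rightarrow> ('n::finite \<Rightarrow> complex) \<Rightarrow> complex" where
  "sigma_k k lam = (\<Sum>I\<in>{I. card I = k}. \<Prod>i\<in>I. lam i)"

text \<open>S_k(R) = sigma_k(lambda(R)); it is real for real R, so we take the real part.\<close>
definition S_k :: "nat \<Rightarrow> real^'n::finite^'n \<Rightarrow> real" where
  "S_k k M = Re (sigma_k k (eigvals M))"

definition omega_op :: "(real^'n::finite) set \<Rightarrow> (real^'n \<Rightarrow> real \<Rightarrow> real^'n \<Rightarrow> real^'n^'n)
    \<Rightarrow> (real^'n \<Rightarrow> real) \<Rightarrow> real^'n \<Rightarrow> real^'n^'n" where
  "omega_op \<Omega> A u x = Hess (closure \<Omega>) u x - A x (u x) (Grad (closure \<Omega>) u x)"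

definition R_op :: "(real^'n::finite) set \<Rightarrow> (real^'n \<Rightarrow> real \<Rightarrow> real^'n \<Rightarrow> real^'n^'n)
    \<Rightarrow> (real^'n \<Rightarrow> real \<Rightarrow> real^'n \<Rightarrow> real^'n^'n) \<Rightarrow> (real^'n \<Rightarrow> real) \<Rightarrow> real^'n \<Rightarrow> real^'n^'n" where
  "R_op \<Omega> A B u x = omega_op \<Omega> A u x - B x (u x) (Grad (closure \<Omega>) u x)"

definition lambda_fun :: "(real^'n::finite) set \<Rightarrow> (real^'n \<Rightarrow> real \<Rightarrow> real^'n \<Rightarrow> real^'n^'n)
    \<Rightarrow> (real^'n \<Rightarrow> real) \<Rightarrow> real" where
  "lambda_fun \<Omega> A u = (INF x\<in>closure \<Omega>. lambda_min (omega_op \<Omega> A u x))"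

definition G_k :: "nat \<Rightarrow> (real^'n::finite) set \<Rightarrow> (real^'n \<Rightarrow> real \<Rightarrow> real^'n \<Rightarrow> real^'n^'n)
    \<Rightarrow> (real^'n \<Rightarrow> real \<Rightarrow> real^'n \<Rightarrow> real^'n^'n) \<Rightarrow> (real^'n \<Rightarrow> real \<Rightarrow> real^'n \<Rightarrow> real)
    \<Rightarrow> (real^'n \<Rightarrow> real) \<Rightarrow> real^'n \<Rightarrow> real" where
  "G_k k \<Omega> A B f u x = ln (S_k k (R_op \<Omega> A B u x)) - ln (f x (u x) (Grad (closure \<Omega>) u x))"

definition mu :: "(real^'n::finite) set \<Rightarrow> (real^'n \<Rightarrow> real \<Rightarrow> real^'n \<Rightarrow> real^'n^'n) \<Rightarrow> real" where
  "mu \<Omega> B = (SUP (x, z, p)\<in>dom_D \<Omega>. opnorm (B x z p))"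

end

theory Submission
  imports Defs "HOL-Computational_Algebra.Fundamental_Theorem_Algebra"
begin

text \<open>
  \<open>S_k\<close> is the sum of the principal \<open>k\<close>-minors, so on matrices \<open>R = \<omega> - B\<close> with \<open>\<omega> \<ge> \<kappa>\<close> symmetric and
  \<open>B\<close> skew it is positive, and its derivative in direction \<open>M\<close> is \<open>\<Sum>\<^sub>I det R\<^sub>I \<cdot> tr (R\<^sub>I\<^sup>-\<^sup>1 M\<^sub>I)\<close>. This is
  positive for rank-one \<open>M = \<xi>\<xi>\<^sup>T\<close> (ellipticity); for skew \<open>M\<close> only the skew part of \<open>R\<^sub>I\<^sup>-\<^sup>1\<close> matters, whose
  norm is at most \<open>\<delta> / ((1 + \<delta>\<^sup>2) \<kappa>)\<close> if \<open>\<parallel>B\<parallel> \<le> \<delta>\<kappa>\<close>. The mean value theorem for \<open>log S_k\<close> along the segment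
  from \<open>R(x, v)\<close> to \<open>R(x, u)\<close>, which stays in this class of matrices, turns the hypothesis on \<open>G_k\<close> into a
  linear elliptic inequality for \<open>u - v\<close>; where \<open>u < v\<close>, the growth of \<open>log f\<close> in \<open>z\<close> compensates that of \<open>B\<close>.
  At an interior negative minimum of \<open>u - v - \<epsilon> exp (\<alpha> x\<^sub>i)\<close> this is contradictory for large \<open>\<alpha>\<close>.
  The boundary statement follows by differentiating \<open>u - v \<ge> 0\<close> along the inner normal.
\<close>

subsection \<open>Principal minors and the characteristic polynomial\<close>

text \<open>The blocks of different sizes have no common matrix type, so a block is padded to full
  size by a scalar c on the complementary diagonal: c = 1 for minors, c = t for the characteristic
  polynomial, c = \<kappa> where an inverse is taken, c = 0 for directions. The bound for the skew
  part of the inverse is attained: if J is skew with J^2 = -1, then \<kappa> (1 - \<delta> J) has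
  the inverse (1 + \<delta> J) / ((1 + \<delta>^2) \<kappa>). In a block of size k each column of a
  skew direction costs this much times the length of the column. For an increment of B in z that
  length is at most \<beta> \<kappa> per unit of z, so \<kappa> cancels and exactly the constant of
  (vii) remains. The compensation by log f therefore leaves no margin, and the strict sign must come
  from the barrier. Its Hessian is of rank one and exceeds its gradient by the factor \<alpha>, so
  ellipticity in a single direction outweighs the dependence of A, B and f on the gradient.\<close>

definition minor_mat :: "'a::comm_ring_1 \<Rightarrow> 'n set \<Rightarrow> 'a^'n::finite^'n \<Rightarrow> 'a^'n^'n" where
  "minor_mat c I M = (\<chi> i j. if i \<in> I \<and> j \<in> I then M $ i $ j else if i = j then c else 0)"

definition pminor :: "'n set \<Rightarrow> 'a::comm_ring_1^'n::finite^'n \<Rightarrow> 'a" where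
  "pminor I M = det (minor_mat 1 I M)"

text \<open>A permutation that moves an index outside I meets an off-diagonal zero. Any other
  permutation fixes the complement and hence maps I into itself, so only entries of M with both
  indices in I occur.\<close>

lemma prod_minor_mat:
  fixes M :: "'a::comm_ring_1^'n::finite^'n"
  assumes p: "p permutes UNIV"
  shows "(\<Prod>i\<in>UNIV. minor_mat c I M $ i $ p i) =
    (\<Prod>i\<in>I. M $ i $ p i) * (\<Prod>i\<in>-I. if i = p i then c else 0)"
proof (cases "\<exists>i\<in>-I. p i \<noteq> i")
  case True
  then obtain i where i: "i \<notin> I" "p i \<noteq> i" by auto
  have "(\<Prod>i\<in>UNIV. minor_mat c I M $ i $ p i) = 0"
    by (rule prod_zero) (use i in \<open>auto simp: minor_mat_def intro!: exI[of _ i]\<close>)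
  moreover have "(\<Prod>i\<in>-I. if i = p i then c else 0) = 0"
    by (rule prod_zero) (use i in \<open>auto intro!: bexI[of _ i]\<close>)
  ultimately show ?thesis by simp
next
  case False
  have inj: "inj p" using p by (simp add: permutes_inj)
  have pI: "p i \<in> I" if "i \<in> I" for i
    using False inj that by (metis ComplI injD)
  have "(\<Prod>i\<in>UNIV. minor_mat c I M $ i $ p i) =
     (\<Prod>i\<in>I. minor_mat c I M $ i $ p i) * (\<Prod>i\<in>-I. minor_mat c I M $ i $ p i)"
    using prod.union_disjoint[of I "-I" "\<lambda>i. minor_mat c I M $ i $ p i"] by simp
  also have "(\<Prod>i\<in>I. minor_mat c I M $ i $ p i) = (\<Prod>i\<in>I. M $ i $ p i)"
    by (rule prod.cong) (auto simp: minor_mat_def pI)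
  also have "(\<Prod>i\<in>-I. minor_mat c I M $ i $ p i) = (\<Prod>i\<in>-I. if i = p i then c else 0)"
    by (rule prod.cong) (use False in \<open>auto simp: minor_mat_def\<close>)
  finally show ?thesis .
qed

lemma det_minor_mat_eq_sum:
  fixes M :: "'a::comm_ring_1^'n::finite^'n"
  shows "det (minor_mat c I M) = (\<Sum>p | p permutes UNIV. of_int (sign p) *
     ((\<Prod>i\<in>I. M $ i $ p i) * (\<Prod>i\<in>-I. if i = p i then c else 0)))"
  unfolding det_def by (rule sum.cong) (auto simp: prod_minor_mat)

text \<open>In every Leibniz term each factor is an entry of M plus, at a fixed point of p, the
  scalar t. Expanding the product sorts the terms by the set I of factors taken from M.\<close>

lemma det_mat_add:
  fixes M :: "'a::comm_ring_1^'n::finite^'n"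
  shows "det (mat t + M) = (\<Sum>I\<in>UNIV. det (minor_mat t I M))"
proof -
  have "(\<Prod>i\<in>UNIV. (mat t + M) $ i $ p i) =
     (\<Sum>I\<in>UNIV. (\<Prod>i\<in>I. M $ i $ p i) * (\<Prod>i\<in>-I. if i = p i then t else 0))" for p
  proof -
    have "(\<Prod>i\<in>UNIV. (mat t + M) $ i $ p i) = (\<Prod>i\<in>UNIV. M $ i $ p i + (if i = p i then t else 0))"
      by (rule prod.cong) (auto simp: mat_def)
    also have "\<dots> = (\<Sum>I\<in>Pow UNIV. (\<Prod>i\<in>I. M $ i $ p i) * (\<Prod>i\<in>UNIV-I. if i = p i then t else 0))"
      by (rule prod_add) simp
    finally show ?thesis by (simp add: Compl_eq_Diff_UNIV)
  qed
  then have "det (mat t + M) = (\<Sum>p | p permutes (UNIV::'n set). \<Sum>I\<in>UNIV. of_int (sign p) *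
     ((\<Prod>i\<in>I. M $ i $ p i) * (\<Prod>i\<in>-I. if i = p i then t else 0)))"
    unfolding det_def by (simp add: sum_distrib_left)
  also have "\<dots> = (\<Sum>I\<in>UNIV. det (minor_mat t I M))"
    unfolding det_minor_mat_eq_sum by (rule sum.swap)
  finally show ?thesis .
qed

lemma det_minor_mat:
  fixes M :: "'a::comm_ring_1^'n::finite^'n"
  shows "det (minor_mat c I M) = c ^ card (-I) * pminor I M"
proof -
  have "(\<Prod>i\<in>-I. if i = p i then c else 0) = c ^ card (-I) * (\<Prod>i\<in>-I. if i = p i then 1 else 0)" for p :: "'n \<Rightarrow> 'n"
    by (subst prod_constant[symmetric], subst prod.distrib[symmetric]) (rule prod.cong, auto)
  then show ?thesis
    unfolding pminor_def det_minor_mat_eq_sum sum_distrib_left by (intro sum.cong) (auto simp: ac_simps)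
qed

lemma pminor_uminus: "pminor I (- M) = (-1) ^ card I * pminor I (M :: 'a::comm_ring_1^'n::finite^'n)"
  unfolding pminor_def det_minor_mat_eq_sum sum_distrib_left
proof (intro sum.cong refl)
  fix p :: "'n \<Rightarrow> 'n"
  have "(\<Prod>i\<in>I. (- M) $ i $ p i) = (-1) ^ card I * (\<Prod>i\<in>I. M $ i $ p i)"
    by (simp add: prod_uminus)
  then show "of_int (sign p) * ((\<Prod>i\<in>I. (- M) $ i $ p i) * (\<Prod>i\<in>- I. if i = p i then 1 else 0)) =
      (-1) ^ card I * (of_int (sign p) * ((\<Prod>i\<in>I. M $ i $ p i) * (\<Prod>i\<in>- I. if i = p i then 1 else 0)))"
    by (simp add: ac_simps)
qed

lemma pminor_cmat: "pminor I (cmat M) = of_real (pminor I M)"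
  unfolding pminor_def det_minor_mat_eq_sum cmat_def
  by (simp add: if_distrib[of complex_of_real] cong: if_cong)

lemma charpoly_cmat:
  fixes M :: "real^'n::finite^'n"
  shows "det (mat t - cmat M) =
    (\<Sum>I\<in>UNIV. (-1) ^ card I * of_real (pminor I M) * t ^ card (- I))"
  using det_mat_add[of t "- cmat M"]
  by (simp add: det_minor_mat pminor_uminus pminor_cmat ac_simps)

text \<open>A characteristic polynomial with free data on index sets. Principal minors and products
  of eigenvalues both fit, so the two expansions can be compared coefficient by coefficient.\<close>

definition minor_poly :: "('n::finite set \<Rightarrow> complex) \<Rightarrow> complex poly" where
  "minor_poly a = (\<Sum>I\<in>UNIV. monom ((-1) ^ card I * a I) (card (- I)))"

lemma poly_minor_poly: "poly (minor_poly a) t = (\<Sum>I\<in>UNIV. (-1) ^ card I * a I * t ^ card (- I))"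
  by (simp add: minor_poly_def poly_sum poly_monom)

lemma coeff_minor_poly:
  fixes a :: "'n::finite set \<Rightarrow> complex"
  assumes "k \<le> CARD('n)"
  shows "coeff (minor_poly a) (CARD('n) - k) = (-1) ^ k * (\<Sum>I | card I = k. a I)"
proof -
  \<comment> \<open>Subtraction on naturals is truncated; with k \<le> CARD('n) these facts make the
    exponent of I equal to n - k only for sets of size k.\<close>
  have c: "card (- I) = CARD('n) - card I" "card I \<le> CARD('n)" for I :: "'n set"
    by (simp_all add: Compl_eq_Diff_UNIV card_Diff_subset card_mono)
  have "coeff (minor_poly a) (CARD('n) - k) = (\<Sum>I\<in>UNIV. if card I = k then (-1) ^ k * a I else 0)"
    unfolding minor_poly_def coeff_sum
  proof (intro sum.cong refl)
    fix I :: "'n set"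
    show "coeff (monom ((-1) ^ card I * a I) (card (- I))) (CARD('n) - k) = (if card I = k then (-1) ^ k * a I else 0)"
      using c(1)[of I] c(2)[of I] assms by auto
  qed
  also have "\<dots> = (\<Sum>I | card I = k. (-1) ^ k * a I)"
    by (simp add: sum.If_cases)
  finally show ?thesis by (simp add: sum_distrib_left)
qed

text \<open>\<open>eigvals\<close> is a choice, so its defining equation needs a witness. The
  fundamental theorem of algebra lists the roots by numbers below the degree, and a bijection
  carries them to the index type.\<close>

lemma charpoly_splits:
  fixes M :: "real^'n::finite^'n"
  shows "\<exists>ev :: 'n \<Rightarrow> complex. \<forall>t. det (mat t - cmat M) = (\<Prod>i\<in>UNIV. t - ev i)"
proof -
  define P where "P = minor_poly (\<lambda>I::'n set. of_real (pminor I M))"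
  have le: "degree P \<le> CARD('n)"
    unfolding P_def minor_poly_def
    by (rule degree_sum_le, simp, rule order_trans[OF degree_monom_le]) (simp add: card_mono)
  have I0: "{I::'n set. card I = 0} = {{}}" by auto
  have "pminor {} M = 1"
  proof -
    have "minor_mat 1 {} M = mat 1" by (simp add: minor_mat_def mat_def)
    then show ?thesis by (simp add: pminor_def)
  qed
  then have c1: "coeff P (CARD('n)) = 1"
    using coeff_minor_poly[of 0 "\<lambda>I::'n set. of_real (pminor I M)"] I0 by (simp add: P_def)
  then have deg: "degree P = CARD('n)" using le le_degree[of P "CARD('n)"] by simp
  then have lead: "lead_coeff P = 1" using c1 by simp
  from complex_poly_decompose'[of P] obtain root where
    root: "smult (lead_coeff P) (\<Prod>i<degree P. [:-root i, 1:]) = P" by blast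
  obtain h where h: "bij_betw h (UNIV :: 'n set) {..<CARD('n)}"
    by (metis card_lessThan finite finite_lessThan finite_same_card_bij)
  have "det (mat t - cmat M) = (\<Prod>i\<in>UNIV. t - root (h i))" for t
  proof -
    have "det (mat t - cmat M) = poly P t"
      by (simp add: charpoly_cmat P_def poly_minor_poly)
    also have "\<dots> = poly (\<Prod>i<degree P. [:-root i, 1:]) t"
      by (subst root[symmetric]) (simp add: lead)
    also have "\<dots> = (\<Prod>i<CARD('n). t - root i)"
      by (simp add: deg poly_prod)
    also have "\<dots> = (\<Prod>i\<in>UNIV. t - root (h i))"
      by (rule prod.reindex_bij_betw[OF h, symmetric])
    finally show ?thesis .
  qed
  then have "\<forall>t. det (mat t - cmat M) = (\<Prod>i\<in>UNIV. t - root (h i))" by blast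
  then show ?thesis by (rule exI[of _ "\<lambda>i. root (h i)"])
qed

theorem S_k_eq_sum_pminor:
  fixes M :: "real^'n::finite^'n"
  assumes "k \<le> CARD('n)"
  shows "S_k k M = (\<Sum>I | card I = k. pminor I M)"
proof -
  define ev where "ev = eigvals M"
  have ev: "det (mat t - cmat M) = (\<Prod>i\<in>UNIV. t - ev i)" for t
    unfolding ev_def eigvals_def using someI_ex[OF charpoly_splits[of M]] by blast
  have "(\<Prod>i\<in>UNIV. t - ev i) = (\<Sum>I\<in>UNIV. (-1) ^ card I * (\<Prod>i\<in>I. ev i) * t ^ card (- I))" for t
  proof -
    have "(\<Prod>i\<in>UNIV. t - ev i) = (\<Prod>i\<in>UNIV. - ev i + t)" by simp
    also have "\<dots> = (\<Sum>I\<in>Pow UNIV. (\<Prod>i\<in>I. - ev i) * (\<Prod>i\<in>UNIV-I. t))"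
      by (rule prod_add) simp
    finally show ?thesis by (simp add: prod_uminus Compl_eq_Diff_UNIV ac_simps)
  qed
  then have "poly (minor_poly (\<lambda>I::'n set. of_real (pminor I M))) t = poly (minor_poly (\<lambda>I. \<Prod>i\<in>I. ev i)) t" for t
    unfolding poly_minor_poly using ev[of t] unfolding charpoly_cmat by simp
  then have "minor_poly (\<lambda>I::'n set. of_real (pminor I M)) = minor_poly (\<lambda>I. \<Prod>i\<in>I. ev i)"
    by (simp add: poly_eq_poly_eq_iff[symmetric] fun_eq_iff)
  then have "(-1) ^ k * complex_of_real (\<Sum>I | card I = k. pminor I M) = (-1) ^ k * (\<Sum>I | card I = k. \<Prod>i\<in>I. ev i)"
    using coeff_minor_poly[OF assms, of "\<lambda>I. of_real (pminor I M)"]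
      coeff_minor_poly[OF assms, of "\<lambda>I. \<Prod>i\<in>I. ev i"] by simp
  then have "sigma_k k ev = complex_of_real (\<Sum>I | card I = k. pminor I M)"
    by (simp add: sigma_k_def)
  then show ?thesis by (simp add: S_k_def ev_def[symmetric])
qed

subsection \<open>Derivatives of principal minors of accretive matrices\<close>

text \<open>The product rule applied to the Leibniz formula. No inverse occurs, so linearity in M
  and joint continuity can be read off.\<close>

definition pminor_deriv :: "'n set \<Rightarrow> real^'n::finite^'n \<Rightarrow> real^'n^'n \<Rightarrow> real" where
  "pminor_deriv I X M = (\<Sum>p | p permutes UNIV. of_int (sign p) *
     ((\<Sum>i\<in>I. M $ i $ p i * (\<Prod>j\<in>I-{i}. X $ j $ p j)) * (\<Prod>i\<in>-I. if i = p i then 1 else 0)))"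

lemma pminor_has_real_derivative:
  "((\<lambda>t. pminor I (X + t *\<^sub>R M)) has_real_derivative pminor_deriv I (X + t *\<^sub>R M) M) (at t)"
  unfolding pminor_def det_minor_mat_eq_sum pminor_deriv_def
  by (auto intro!: derivative_eq_intros has_field_derivative_prod sum.cong simp: algebra_simps)

lemma linear_pminor_deriv: "linear (pminor_deriv I X)"
  unfolding pminor_deriv_def
  by (rule linearI) (simp_all add: algebra_simps sum.distrib sum_distrib_left)

lemma continuous_on_pminor_deriv:
  "continuous_on S (\<lambda>(X, M). pminor_deriv I X M)"
  unfolding pminor_deriv_def case_prod_unfold by (intro continuous_intros)

lemma continuous_on_pminor: "continuous_on S (pminor I :: real^'n::finite^'n \<Rightarrow> real)"
  unfolding pminor_def[abs_def] det_minor_mat_eq_sum by (intro continuous_intros)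

lemma pminor_UNIV: "pminor UNIV M = det M"
proof -
  have "minor_mat 1 UNIV M = M" by (simp add: minor_mat_def vec_eq_iff)
  then show ?thesis by (simp add: pminor_def)
qed

lemma minor_mat_add_scaleR:
  "minor_mat c I (X + t *\<^sub>R M) = minor_mat c I X + t *\<^sub>R minor_mat 0 I (M :: real^'n::finite^'n)"
  by (simp add: minor_mat_def vec_eq_iff)

lemma pminor_deriv_mat_1: "pminor_deriv UNIV (mat 1) M = trace M"
proof -
  have "(\<Sum>i\<in>UNIV. M $ i $ p i * (\<Prod>j\<in>UNIV-{i}. mat 1 $ j $ p j)) = (if p = id then trace M else 0)"
    if p: "p permutes UNIV" for p :: "'a \<Rightarrow> 'a"
  proof (cases "p = id")
    case True
    then show ?thesis by (simp add: mat_def trace_def)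
  next
    case False
    then obtain a where a: "p a \<noteq> a" by (auto simp: fun_eq_iff)
    have "p (p a) \<noteq> p a" using a p by (metis permutes_inj injD)
    \<comment> \<open>A permutation other than the identity moves both a and p a, so a zero factor
      survives the removal of any single index i.\<close>
    have "(\<Prod>j\<in>UNIV-{i}. mat 1 $ j $ p j) = (0::real)" for i
    proof (rule prod_zero)
      show "\<exists>j\<in>UNIV-{i}. mat 1 $ j $ p j = (0::real)"
        using a \<open>p (p a) \<noteq> p a\<close>
        by (intro bexI[of _ "if i = a then p a else a"]) (auto simp: mat_def)
    qed simp
    then show ?thesis using False by (simp only: mult_zero_right sum.neutral_const if_False)
  qed
  then have "pminor_deriv UNIV (mat 1) M = (\<Sum>p | p permutes (UNIV :: 'a set). of_int (sign p) * (if p = id then trace M else 0))"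
    unfolding pminor_deriv_def by - (rule sum.cong[OF refl], simp only: mem_Collect_eq Compl_UNIV_eq prod.empty mult_1_right)
  also have "\<dots> = (\<Sum>p | p permutes (UNIV :: 'a set). if p = id then trace M else 0)"
    by (rule sum.cong) (auto simp: sign_id)
  also have "\<dots> = trace M"
    by (simp add: permutes_id finite_permutations)
  finally show ?thesis .
qed

lemma matrix_add_scaleR_mult:
  fixes X Y M :: "real^'n::finite^'n"
  assumes "X ** Y = mat 1"
  shows "X + t *\<^sub>R M = X ** (mat 1 + t *\<^sub>R (Y ** M))"
  using assms by (simp add: matrix_add_ldistrib matrix_mul_assoc matrix_scalar_ac scalar_matrix_assoc[symmetric])

text \<open>Jacobi's formula, reduced to the identity matrix by factoring X out of X + t M.\<close>

lemma det_has_real_derivative: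
  fixes X Y M :: "real^'n::finite^'n"
  assumes "X ** Y = mat 1"
  shows "((\<lambda>t. det (X + t *\<^sub>R M)) has_real_derivative det X * trace (Y ** M)) (at 0)"
proof -
  have "((\<lambda>t. det (mat 1 + t *\<^sub>R (Y ** M))) has_real_derivative trace (Y ** M)) (at 0)"
    using pminor_has_real_derivative[of UNIV "mat 1" "Y ** M" 0]
    by (simp add: pminor_UNIV pminor_deriv_mat_1)
  then have "((\<lambda>t. det X * det (mat 1 + t *\<^sub>R (Y ** M))) has_real_derivative det X * trace (Y ** M)) (at 0)"
    by (rule DERIV_cmult)
  then show ?thesis by (simp add: matrix_add_scaleR_mult[OF assms] det_mul)
qed

text \<open>Two derivatives of the determinant of the padded block: the padding contributes a
  constant power of c, and Jacobi's formula gives the trace. As c is free, it can be matched to the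
  coercivity constant.\<close>

lemma pminor_deriv_eq_trace:
  fixes X M Y :: "real^'n::finite^'n"
  assumes "c \<noteq> 0" "minor_mat c I X ** Y = mat 1"
  shows "pminor_deriv I X M = pminor I X * trace (Y ** minor_mat 0 I M)"
proof -
  have "((\<lambda>t. c ^ card (-I) * pminor I (X + t *\<^sub>R M)) has_real_derivative c ^ card (-I) * pminor_deriv I X M) (at 0)"
    using DERIV_cmult[OF pminor_has_real_derivative[of I X M 0]] by simp
  moreover have "((\<lambda>t. c ^ card (-I) * pminor I (X + t *\<^sub>R M)) has_real_derivative
      c ^ card (-I) * (pminor I X * trace (Y ** minor_mat 0 I M))) (at 0)"
    using det_has_real_derivative[OF assms(2), of "minor_mat 0 I M"]
    by (simp add: minor_mat_add_scaleR[symmetric] det_minor_mat mult.assoc)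
  ultimately show ?thesis using DERIV_unique assms(1) by fastforce
qed

section \<open>Accretive matrices and their padded blocks\<close>

definition restrict_vec :: "'n set \<Rightarrow> real^'n::finite \<Rightarrow> real^'n" where
  "restrict_vec I \<xi> = (\<chi> i. if i \<in> I then \<xi> $ i else 0)"

lemma inner_minor_mat_mult:
  "\<eta> \<bullet> (minor_mat c I M *v \<xi>) = restrict_vec I \<eta> \<bullet> (M *v restrict_vec I \<xi>) + c * ((\<eta> - restrict_vec I \<eta>) \<bullet> (\<xi> - restrict_vec I \<xi>))"
proof -
  have "(minor_mat c I M *v \<xi>) $ i = (if i \<in> I then (M *v restrict_vec I \<xi>) $ i else c * \<xi> $ i)" for i
    unfolding matrix_vector_mult_def minor_mat_def restrict_vec_def
    by (auto simp: if_distrib[of "\<lambda>x. x * _"] intro!: sum.cong cong: if_cong)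
  then show ?thesis
    unfolding inner_vec_def sum_distrib_left sum.distrib[symmetric]
    by (intro sum.cong) (auto simp: restrict_vec_def)
qed

lemma norm_restrict_vec_le: "norm (restrict_vec I \<xi>) \<le> norm \<xi>"
  by (rule norm_le_componentwise_cart) (simp add: restrict_vec_def)

lemma inner_restrict_vec_split:
  "\<xi> \<bullet> \<xi> = restrict_vec I \<xi> \<bullet> restrict_vec I \<xi> + (\<xi> - restrict_vec I \<xi>) \<bullet> (\<xi> - restrict_vec I \<xi>)"
  unfolding inner_vec_def sum.distrib[symmetric] by (intro sum.cong) (auto simp: restrict_vec_def)

text \<open>The second clause says that the skew part has norm at most \<delta> \<kappa>, without
  splitting X. Both clauses are convex closed conditions on X, which serves the segment argument and
  the compactness argument.\<close>

definition accretive_mat :: "real \<Rightarrow> real \<Rightarrow> real^'n::finite^'n \<Rightarrow> bool" where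
  "accretive_mat \<kappa> \<delta> X \<longleftrightarrow> (\<forall>\<xi>. \<kappa> * (\<xi> \<bullet> \<xi>) \<le> \<xi> \<bullet> (X *v \<xi>)) \<and>
     (\<forall>\<xi> \<eta>. \<bar>\<xi> \<bullet> (X *v \<eta>) - \<eta> \<bullet> (X *v \<xi>)\<bar> \<le> 2 * \<delta> * \<kappa> * norm \<xi> * norm \<eta>)"

text \<open>The padding is symmetric and adds exactly \<kappa> times the squared length of the
  complementary component, so neither constant gets worse.\<close>

lemma accretive_minor_mat:
  assumes "accretive_mat \<kappa> \<delta> X" "0 < \<kappa>" "0 < \<delta>"
  shows "accretive_mat \<kappa> \<delta> (minor_mat \<kappa> I X)"
  unfolding accretive_mat_def
proof (intro conjI allI)
  fix \<xi> \<eta> :: "real^'a"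
  show "\<kappa> * (\<xi> \<bullet> \<xi>) \<le> \<xi> \<bullet> (minor_mat \<kappa> I X *v \<xi>)"
    unfolding inner_minor_mat_mult inner_restrict_vec_split[of \<xi> I]
    using assms by (simp add: accretive_mat_def distrib_left)
  have "\<bar>\<xi> \<bullet> (minor_mat \<kappa> I X *v \<eta>) - \<eta> \<bullet> (minor_mat \<kappa> I X *v \<xi>)\<bar> \<le> 2 * \<delta> * \<kappa> * norm (restrict_vec I \<xi>) * norm (restrict_vec I \<eta>)"
    unfolding inner_minor_mat_mult using assms by (simp add: accretive_mat_def inner_commute)
  also have "\<dots> \<le> 2 * \<delta> * \<kappa> * norm \<xi> * norm \<eta>"
    using assms by (intro mult_mono norm_restrict_vec_le) auto
  finally show "\<bar>\<xi> \<bullet> (minor_mat \<kappa> I X *v \<eta>) - \<eta> \<bullet> (minor_mat \<kappa> I X *v \<xi>)\<bar> \<le> 2 * \<delta> * \<kappa> * norm \<xi> * norm \<eta>" .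
qed

lemma accretive_inverse:
  assumes "accretive_mat \<kappa> \<delta> X" "0 < \<kappa>"
  obtains Y where "X ** Y = mat 1" "Y ** X = mat 1"
proof -
  have "\<xi> = 0" if "X *v \<xi> = 0" for \<xi>
  proof -
    have "\<kappa> * (\<xi> \<bullet> \<xi>) \<le> 0" using assms(1) that by (metis accretive_mat_def inner_zero_right)
    then show ?thesis using assms(2) by (simp add: mult_le_0_iff) (metis inner_ge_zero inner_eq_zero_iff order_antisym)
  qed
  then obtain Y where "Y ** X = mat 1" using matrix_left_invertible_ker by blast
  then show ?thesis using that matrix_left_right_inverse by blast
qed

text \<open>On the segment from the identity to X the quadratic form stays positive definite, so the
  determinant starts at 1 and cannot reach zero.\<close>

lemma det_pos_of_accretive:
  assumes "accretive_mat \<kappa> \<delta> X" "0 < \<kappa>"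
  shows "0 < det X"
proof (rule ccontr)
  assume "\<not> 0 < det X"
  moreover have c: "continuous_on {0..1::real} (\<lambda>t. det ((1 - t) *\<^sub>R mat 1 + t *\<^sub>R X))"
    unfolding det_def by (intro continuous_intros)
  ultimately obtain t where t: "0 \<le> t" "t \<le> 1" "det ((1 - t) *\<^sub>R mat 1 + t *\<^sub>R X) = 0"
    using IVT2'[of "\<lambda>t. det ((1 - t) *\<^sub>R mat 1 + t *\<^sub>R X)" 1 0 0] by auto
  then obtain \<xi> where \<xi>: "\<xi> \<noteq> 0" "((1 - t) *\<^sub>R mat 1 + t *\<^sub>R X) *v \<xi> = 0"
    by (metis invertible_det_nz invertible_left_inverse matrix_left_invertible_ker)
  have "0 = \<xi> \<bullet> (((1 - t) *\<^sub>R mat 1 + t *\<^sub>R X) *v \<xi>)" using \<xi> by simp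
  also have "\<dots> = (1 - t) * (\<xi> \<bullet> \<xi>) + t * (\<xi> \<bullet> (X *v \<xi>))"
    by (simp add: matrix_vector_mult_add_rdistrib scaleR_matrix_vector_assoc[symmetric] inner_add_right)
  also have "\<dots> \<ge> (1 - t) * (\<xi> \<bullet> \<xi>) + t * (\<kappa> * (\<xi> \<bullet> \<xi>))"
    using assms t by (intro add_left_mono mult_left_mono) (auto simp: accretive_mat_def)
  finally have "((1 - t) + t * \<kappa>) * (\<xi> \<bullet> \<xi>) \<le> 0" by (simp add: algebra_simps)
  moreover have "\<xi> \<bullet> \<xi> > 0" using \<xi> by simp
  moreover have "(1 - t) + t * \<kappa> > 0" using t assms(2)
    by (cases "t = 1") (auto intro: add_pos_nonneg)
  ultimately show False by (simp add: mult_le_0_iff)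
qed

lemma pminor_pos:
  assumes "accretive_mat \<kappa> \<delta> X" "0 < \<kappa>" "0 < \<delta>"
  shows "0 < pminor I X"
  using det_pos_of_accretive[OF accretive_minor_mat[OF assms, of I] assms(2)] assms(2)
  by (simp add: det_minor_mat zero_less_mult_iff)

section \<open>Rank-one and positive semidefinite directions\<close>

definition outer :: "real^'n::finite \<Rightarrow> real^'n^'n" where
  "outer \<xi> = (\<chi> i j. \<xi> $ i * \<xi> $ j)"

lemma trace_mult_outer: "trace (Y ** outer \<xi>) = \<xi> \<bullet> (Y *v \<xi>)"
  by (simp add: trace_def matrix_matrix_mult_def outer_def inner_vec_def matrix_vector_mult_def
      sum_distrib_left sum_distrib_right ac_simps)

lemma minor_mat_outer: "minor_mat 0 I (outer \<xi>) = outer (restrict_vec I \<xi>)"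
  by (auto simp: minor_mat_def outer_def restrict_vec_def vec_eq_iff)

text \<open>If \<open>\<eta>\<close> solves the padded system with right-hand side
  \<open>restrict_vec I \<xi>\<close>, the trace in Jacobi's formula is the quadratic form of the
  padded block at \<open>\<eta>\<close>, and coercivity applies.\<close>

lemma pminor_deriv_outer:
  assumes "accretive_mat \<kappa> \<delta> X" "0 < \<kappa>" "0 < \<delta>"
  shows "0 \<le> pminor_deriv I X (outer \<xi>)"
    and "restrict_vec I \<xi> \<noteq> 0 \<Longrightarrow> 0 < pminor_deriv I X (outer \<xi>)"
proof -
  have acc: "accretive_mat \<kappa> \<delta> (minor_mat \<kappa> I X)" by (rule accretive_minor_mat[OF assms])
  then obtain Y where Y: "minor_mat \<kappa> I X ** Y = mat 1"
    using accretive_inverse assms(2) by blast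
  define \<eta> where "\<eta> = Y *v restrict_vec I \<xi>"
  have \<eta>: "minor_mat \<kappa> I X *v \<eta> = restrict_vec I \<xi>"
    by (simp add: \<eta>_def matrix_vector_mul_assoc Y)
  have "pminor_deriv I X (outer \<xi>) = pminor I X * (\<eta> \<bullet> (minor_mat \<kappa> I X *v \<eta>))"
    using assms(2) by (simp add: pminor_deriv_eq_trace[OF _ Y] minor_mat_outer trace_mult_outer \<eta>)
       (simp add: \<eta>_def inner_commute)
  moreover have "\<kappa> * (\<eta> \<bullet> \<eta>) \<le> \<eta> \<bullet> (minor_mat \<kappa> I X *v \<eta>)"
    using acc by (simp add: accretive_mat_def)
  moreover have "0 < pminor I X" by (rule pminor_pos[OF assms])
  moreover have "\<eta> \<noteq> 0" if "restrict_vec I \<xi> \<noteq> 0" using that \<eta> by auto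
  ultimately show "0 \<le> pminor_deriv I X (outer \<xi>)"
    and "restrict_vec I \<xi> \<noteq> 0 \<Longrightarrow> 0 < pminor_deriv I X (outer \<xi>)"
    using assms(2) by (smt (verit) mult_nonneg_nonneg inner_ge_zero mult_pos_pos inner_gt_zero_iff)+
qed

lemma psd_cauchy_schwarz:
  fixes M :: "real^'n::finite^'n"
  assumes "psd M" "symmetric_mat M"
  shows "(\<xi> \<bullet> (M *v \<eta>))\<^sup>2 \<le> (\<xi> \<bullet> (M *v \<xi>)) * (\<eta> \<bullet> (M *v \<eta>))"
proof -
  define a b c where "a = \<xi> \<bullet> (M *v \<xi>)" and "b = \<xi> \<bullet> (M *v \<eta>)" and "c = \<eta> \<bullet> (M *v \<eta>)"
  have sym: "\<eta> \<bullet> (M *v \<xi>) = b"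
    unfolding b_def using assms(2) by (metis symmetric_mat_def dot_lmul_matrix vector_transpose_matrix inner_commute)
  have q: "0 \<le> s\<^sup>2 * a + 2 * s * t * b + t\<^sup>2 * c" for s t
  proof -
    have "0 \<le> (s *\<^sub>R \<xi> + t *\<^sub>R \<eta>) \<bullet> (M *v (s *\<^sub>R \<xi> + t *\<^sub>R \<eta>))"
      using assms(1) by (simp add: psd_def)
    also have "\<dots> = s\<^sup>2 * a + 2 * s * t * b + t\<^sup>2 * c"
      using sym by (simp add: matrix_vector_right_distrib matrix_vector_mult_scaleR inner_add_left inner_add_right
          a_def b_def c_def power2_eq_square algebra_simps)
    finally show ?thesis .
  qed
  have "0 \<le> a" "0 \<le> c" using q[of 1 0] q[of 0 1] by auto
  have "b\<^sup>2 \<le> a * c"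
  proof (cases "a = 0")
    case True
    have "b = 0"
    proof (rule ccontr)
      assume "b \<noteq> 0"
      \<comment> \<open>For a = 0 the form is linear in s; this s gives it the value -1.\<close>
      have "0 \<le> 2 * (-(c + 1) / (2 * b)) * b + c" using q[of "-(c + 1) / (2 * b)" 1] True by simp
      also have "\<dots> = -1" using \<open>b \<noteq> 0\<close> by (simp add: field_simps)
      finally show False by simp
    qed
    then show ?thesis using True by simp
  next
    case False
    have "0 \<le> a * (a * c - b\<^sup>2)" using q[of "-b" a] by (simp add: power2_eq_square algebra_simps)
    then show ?thesis using False \<open>0 \<le> a\<close> by (simp add: zero_le_mult_iff)
  qed
  then show ?thesis by (simp add: a_def b_def c_def)
qed

lemma outer_mult_vec: "outer \<xi> *v \<eta> = (\<xi> \<bullet> \<eta>) *\<^sub>R \<xi>"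
  by (simp add: outer_def vec_eq_iff matrix_vector_mult_def inner_vec_def sum_distrib_left sum_distrib_right ac_simps)

text \<open>Symmetric elimination splits off one rank-one summand per nonzero row.\<close>
lemma linear_nonneg_on_psd:
  fixes L :: "real^'n::finite^'n \<Rightarrow> real"
  assumes L: "linear L" and nonneg: "\<And>\<xi>. 0 \<le> L (outer \<xi>)"
    and "psd M" "symmetric_mat M"
  shows "0 \<le> L M"
  using assms(3,4)
proof (induction "card {i. M $ i \<noteq> 0}" arbitrary: M rule: less_induct)
  case less
  show ?case
  proof (cases "M = 0")
    case True
    then show ?thesis using L by (simp add: linear_0)
  next
    case False
    have entry: "\<xi> \<bullet> (M *v axis i 1) = \<xi> \<bullet> M $ i" for \<xi> i
    proof -
      have "M *v axis i 1 = M $ i"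
        using less.prems(2) by (simp add: matrix_vector_mult_basis symmetric_mat_def vec_eq_iff column_def transpose_def)
      then show ?thesis by simp
    qed
    obtain i where i: "M $ i \<noteq> 0" using False by (auto simp: vec_eq_iff)
    define d where "d = M $ i $ i"
    have d: "axis i 1 \<bullet> (M *v axis i 1) = d" by (simp add: entry d_def inner_axis')
    \<comment> \<open>Used twice: a nonzero row must have a positive diagonal entry, and subtracting
      the rank-one part of that row leaves a positive semidefinite matrix.\<close>
    have cs: "(\<xi> \<bullet> M $ i)\<^sup>2 \<le> (\<xi> \<bullet> (M *v \<xi>)) * d" for \<xi>
      using psd_cauchy_schwarz[OF less.prems, of \<xi> "axis i 1"] unfolding d by (simp only: entry)
    have "d \<noteq> 0"
    proof
      assume "d = 0"
      then have "(M $ i \<bullet> M $ i)\<^sup>2 \<le> 0" using cs[of "M $ i"] by simp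
      then show False using i by simp
    qed
    moreover have "0 \<le> d" using less.prems(1) d unfolding psd_def by metis
    ultimately have "0 < d" by simp
    define \<zeta> where "\<zeta> = (1 / sqrt d) *\<^sub>R M $ i"
    define M' where "M' = M - outer \<zeta>"
    have out: "outer \<zeta> $ j $ l = M $ i $ j * M $ i $ l / d" for j l
      using \<open>0 < d\<close> by (simp add: outer_def \<zeta>_def)
    have symM: "M $ j $ l = M $ l $ j" for j l
      using less.prems(2) by (simp add: symmetric_mat_def vec_eq_iff transpose_def)
    have "M' $ i = 0" using \<open>0 < d\<close> by (simp add: M'_def vec_eq_iff out d_def)
    moreover have "M' $ j = 0" if "M $ j = 0" for j
      using that symM[of i j] by (simp add: M'_def vec_eq_iff out)
    ultimately have "card {j. M' $ j \<noteq> 0} < card {j. M $ j \<noteq> 0}"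
      using i by (intro psubset_card_mono) auto
    moreover have "psd M'"
      unfolding psd_def
    proof
      fix \<xi>
      have "\<xi> \<bullet> (outer \<zeta> *v \<xi>) = (\<xi> \<bullet> M $ i)\<^sup>2 / d"
        using \<open>0 < d\<close> by (simp add: outer_mult_vec \<zeta>_def inner_commute power2_eq_square)
      also have "\<dots> \<le> \<xi> \<bullet> (M *v \<xi>)" using cs[of \<xi>] \<open>0 < d\<close> by (simp add: divide_le_eq)
      finally show "0 \<le> \<xi> \<bullet> (M' *v \<xi>)"
        by (simp add: M'_def matrix_vector_mult_diff_rdistrib inner_diff_right)
    qed
    moreover have "symmetric_mat M'"
      unfolding symmetric_mat_def M'_def using symM by (simp add: vec_eq_iff transpose_def out)
    ultimately have "0 \<le> L M'" by (rule less.hyps)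
    moreover have "L M = L M' + L (outer \<zeta>)" using L by (simp add: M'_def linear_diff)
    ultimately show ?thesis using nonneg[of \<zeta>] by simp
  qed
qed

section \<open>Skew directions\<close>

lemma skew_inverse_bound_sum:
  fixes X :: "real^'n::finite^'n"
  assumes acc: "accretive_mat \<kappa> \<delta> X" and "0 < \<kappa>" "0 < \<delta>" "\<delta> < 1"
  shows "\<bar>(X *v p) \<bullet> r - (X *v r) \<bullet> p\<bar> \<le> \<delta> / ((1 + \<delta>\<^sup>2) * \<kappa>) * ((X *v p) \<bullet> (X *v p) + (X *v r) \<bullet> (X *v r))"
proof (cases "p = 0 \<and> r = 0")
  case True
  then show ?thesis by simp
next
  case False
  \<comment> \<open>For the complex vector z = p + i r, the number q + i b is the Hermitian product
    of z with X z, while E and m are the squared lengths of X z and z. The claim bounds the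
    imaginary part b by E.\<close>
  define q b where "q = p \<bullet> (X *v p) + r \<bullet> (X *v r)" and "b = p \<bullet> (X *v r) - r \<bullet> (X *v p)"
  define E where "E = (X *v p) \<bullet> (X *v p) + (X *v r) \<bullet> (X *v r)"
  define m where "m = p \<bullet> p + r \<bullet> r"
  have "0 < m" using False unfolding m_def
    by (metis add_nonneg_eq_0_iff inner_eq_zero_iff inner_ge_zero add_nonneg_nonneg order_le_less)
  have mq: "\<kappa> * m \<le> q" using acc by (simp add: accretive_mat_def q_def m_def distrib_left add_mono)
  then have "0 < q" using \<open>0 < m\<close> \<open>0 < \<kappa>\<close> by (smt (verit) mult_pos_pos)
  have "\<bar>b\<bar> \<le> 2 * \<delta> * \<kappa> * norm p * norm r" using acc by (simp add: accretive_mat_def b_def)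
  also have "\<dots> = \<delta> * \<kappa> * (2 * norm p * norm r)" by simp
  also have "\<dots> \<le> \<delta> * \<kappa> * m"
    using sum_squares_bound[of "norm p" "norm r"] assms
    by (intro mult_left_mono) (auto simp: m_def power2_norm_eq_inner)
  also have "\<dots> \<le> \<delta> * q" using mq assms by simp
  finally have bq: "\<bar>b\<bar> \<le> \<delta> * q" .
  \<comment> \<open>The square expanded next is that of X z - \<kappa> (1 + i \<tau>) z. Once
    \<kappa> m is replaced by q, the lower bound obtained for E is largest at this \<tau>.\<close>
  define \<tau> where "\<tau> = b / q"
  have "0 \<le> (X *v p - \<kappa> *\<^sub>R (p - \<tau> *\<^sub>R r)) \<bullet> (X *v p - \<kappa> *\<^sub>R (p - \<tau> *\<^sub>R r)) +
       (X *v r - \<kappa> *\<^sub>R (r + \<tau> *\<^sub>R p)) \<bullet> (X *v r - \<kappa> *\<^sub>R (r + \<tau> *\<^sub>R p))" by simp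
  also have "\<dots> = E - 2 * \<kappa> * (q + \<tau> * b) + \<kappa>\<^sup>2 * (1 + \<tau>\<^sup>2) * m"
    by (simp add: E_def q_def b_def m_def inner_diff_left inner_diff_right inner_add_left inner_add_right
        inner_commute power2_eq_square algebra_simps)
  also have "\<kappa>\<^sup>2 * (1 + \<tau>\<^sup>2) * m = \<kappa> * (1 + \<tau>\<^sup>2) * (\<kappa> * m)" by (simp add: power2_eq_square)
  also have "\<dots> \<le> \<kappa> * (1 + \<tau>\<^sup>2) * q" using mq assms by (intro mult_left_mono) auto
  finally have "\<kappa> * (q + 2 * (\<tau> * b) - \<tau>\<^sup>2 * q) \<le> E" by (simp add: algebra_simps)
  moreover have "q + 2 * (\<tau> * b) - \<tau>\<^sup>2 * q = q + b\<^sup>2 / q"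
    using \<open>0 < q\<close> by (simp add: \<tau>_def power2_eq_square field_simps)
  ultimately have E: "\<kappa> * (q + b\<^sup>2 / q) \<le> E" by simp
  \<comment> \<open>In terms of s = |b| / q \<le> \<delta> < 1 this is the monotonicity of s / (1 +
    s^2) on the unit interval.\<close>
  have "(1 + \<delta>\<^sup>2) * \<bar>b\<bar> * q \<le> \<delta> * (q\<^sup>2 + b\<^sup>2)"
  proof -
    have "0 \<le> (\<delta> * q - \<bar>b\<bar>) * (q - \<delta> * \<bar>b\<bar>)"
    proof (rule mult_nonneg_nonneg)
      have "\<delta> * \<bar>b\<bar> \<le> 1 * (\<delta> * q)" using bq assms by (intro mult_mono) auto
      also have "\<dots> \<le> q" using \<open>0 < q\<close> assms by simp
      finally show "0 \<le> q - \<delta> * \<bar>b\<bar>" by simp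
    qed (use bq in simp)
    also have "\<dots> = \<delta> * (q\<^sup>2 + \<bar>b\<bar>\<^sup>2) - (1 + \<delta>\<^sup>2) * \<bar>b\<bar> * q" by (simp only: power2_eq_square) algebra
    finally show ?thesis by simp
  qed
  then have "(1 + \<delta>\<^sup>2) * \<bar>b\<bar> \<le> \<delta> * (q + b\<^sup>2 / q)"
    using \<open>0 < q\<close> by (simp add: field_simps power2_eq_square)
  then have "\<kappa> * ((1 + \<delta>\<^sup>2) * \<bar>b\<bar>) \<le> \<kappa> * (\<delta> * (q + b\<^sup>2 / q))" using assms by simp
  also have "\<dots> = \<delta> * (\<kappa> * (q + b\<^sup>2 / q))" by simp
  also have "\<dots> \<le> \<delta> * E" using E assms by (intro mult_left_mono) auto
  finally have "((1 + \<delta>\<^sup>2) * \<kappa>) * \<bar>b\<bar> \<le> \<delta> * E" by (simp add: ac_simps)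
  moreover have "0 < (1 + \<delta>\<^sup>2) * \<kappa>" using assms by (simp add: add_pos_nonneg)
  ultimately have "\<bar>b\<bar> \<le> \<delta> / ((1 + \<delta>\<^sup>2) * \<kappa>) * E" by (simp add: pos_le_divide_eq mult.commute)
  then show ?thesis by (simp add: b_def E_def inner_commute abs_minus_commute)
qed

text \<open>Scaling both vectors to the common length |a| |b| turns the bound by a sum of squares
  into one by a product.\<close>

lemma skew_inverse_bound:
  fixes X Y :: "real^'n::finite^'n"
  assumes acc: "accretive_mat \<kappa> \<delta> X" and "0 < \<kappa>" "0 < \<delta>" "\<delta> < 1" and Y: "X ** Y = mat 1"
  shows "\<bar>a \<bullet> (Y *v b) - b \<bullet> (Y *v a)\<bar> \<le> 2 * (\<delta> / ((1 + \<delta>\<^sup>2) * \<kappa>)) * norm a * norm b"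
proof (cases "a = 0 \<or> b = 0")
  case True
  then show ?thesis by auto
next
  case False
  define c where "c = \<delta> / ((1 + \<delta>\<^sup>2) * \<kappa>)"
  define s where "s = norm a * norm b"
  have "0 < s" using False by (simp add: s_def)
  have XY: "X *v (Y *v z) = z" for z by (simp add: matrix_vector_mul_assoc Y)
  have "\<bar>(norm b *\<^sub>R a) \<bullet> (Y *v (norm a *\<^sub>R b)) - (norm a *\<^sub>R b) \<bullet> (Y *v (norm b *\<^sub>R a))\<bar>
    \<le> c * ((norm b *\<^sub>R a) \<bullet> (norm b *\<^sub>R a) + (norm a *\<^sub>R b) \<bullet> (norm a *\<^sub>R b))"
    using skew_inverse_bound_sum[OF acc assms(2-4), of "Y *v (norm b *\<^sub>R a)" "Y *v (norm a *\<^sub>R b)"]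
    unfolding XY c_def .
  then have "\<bar>norm b * (norm a * (a \<bullet> (Y *v b))) - norm a * (norm b * (b \<bullet> (Y *v a)))\<bar> \<le> s * (2 * c * s)"
    unfolding s_def
    by (simp add: matrix_vector_mult_scaleR dot_square_norm power2_eq_square ac_simps)
  moreover have "norm b * (norm a * (a \<bullet> (Y *v b))) - norm a * (norm b * (b \<bullet> (Y *v a)))
      = s * (a \<bullet> (Y *v b) - b \<bullet> (Y *v a))" by (simp add: s_def algebra_simps)
  ultimately have "\<bar>s * (a \<bullet> (Y *v b) - b \<bullet> (Y *v a))\<bar> \<le> s * (2 * c * s)"
    by (simp only:)
  then have "s * \<bar>a \<bullet> (Y *v b) - b \<bullet> (Y *v a)\<bar> \<le> s * (2 * c * s)"
    using \<open>0 < s\<close> by (simp only: abs_mult abs_of_pos)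
  then have "\<bar>a \<bullet> (Y *v b) - b \<bullet> (Y *v a)\<bar> \<le> 2 * c * s"
    using \<open>0 < s\<close> by (rule mult_left_le_imp_le)
  then show ?thesis by (simp only: s_def c_def mult.assoc)
qed

lemma trace_mult_eq_sum: "trace (Y ** N) = (\<Sum>i\<in>UNIV. axis i 1 \<bullet> (Y *v (N *v axis i 1)))"
  for Y N :: "real^'n::finite^'n"
  unfolding trace_def
proof (rule sum.cong[OF refl])
  fix i
  have "(Y ** N) $ i $ i = (column i (Y ** N)) $ i" by (simp add: column_def)
  also have "\<dots> = ((Y ** N) *v axis i 1) $ i" by (simp add: matrix_vector_mult_basis)
  also have "\<dots> = axis i 1 \<bullet> (Y *v (N *v axis i 1))"
    by (simp only: matrix_vector_mul_assoc[symmetric]) (simp add: inner_axis')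
  finally show "(Y ** N) $ i $ i = axis i 1 \<bullet> (Y *v (N *v axis i 1))" .
qed

lemma skew_mat_nth:
  assumes "skew_mat N"
  shows "N $ j $ i = - N $ i $ j"
proof -
  have "transpose N $ i $ j = (- N) $ i $ j" using assms by (simp only: skew_mat_def)
  then show ?thesis by (simp add: transpose_def)
qed

lemma inner_transpose_mult: "a \<bullet> (transpose Y *v b) = (Y *v a) \<bullet> b"
  for Y :: "real^'n::finite^'n"
  by (simp only: dot_lmul_matrix[symmetric] vector_transpose_matrix)

text \<open>Transposing Y flips the sign of its trace against a skew N, so only the skew part of Y
  counts. The sum shows that part in the antisymmetrised form to which
  \<open>skew_inverse_bound\<close> applies.\<close>

lemma trace_mult_skew:
  fixes Y N :: "real^'n::finite^'n"
  assumes "skew_mat N"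
  shows "2 * trace (Y ** N) =
    (\<Sum>i\<in>UNIV. axis i 1 \<bullet> (Y *v (N *v axis i 1)) - (N *v axis i 1) \<bullet> (Y *v axis i 1))"
proof -
  have tr: "trace (transpose Y ** N) = - trace (Y ** N)"
  proof -
    have "trace (transpose Y ** N) = trace (transpose (transpose Y ** N))"
      by (simp add: trace_def transpose_def)
    also have "transpose (transpose Y ** N) = - (N ** Y)"
      using assms by (simp add: skew_mat_def matrix_transpose_mul) (simp add: matrix_matrix_mult_def vec_eq_iff sum_negf)
    also have "trace \<dots> = - trace (Y ** N)" by (subst trace_mul_sym) (simp add: trace_def matrix_matrix_mult_def vec_eq_iff sum_negf)
    finally show ?thesis .
  qed
  have "2 * trace (Y ** N) = trace (Y ** N) - trace (transpose Y ** N)" using tr by simp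
  also have "\<dots> = (\<Sum>i\<in>UNIV. axis i 1 \<bullet> (Y *v (N *v axis i 1)) - axis i 1 \<bullet> (transpose Y *v (N *v axis i 1)))"
    by (simp only: trace_mult_eq_sum sum_subtractf)
  also have "\<dots> = (\<Sum>i\<in>UNIV. axis i 1 \<bullet> (Y *v (N *v axis i 1)) - (N *v axis i 1) \<bullet> (Y *v axis i 1))"
    by (simp only: inner_transpose_mult inner_commute)
  finally show ?thesis .
qed

text \<open>Only the columns with index in I survive in \<open>minor_mat 0 I N\<close>, and each
  contributes at most \<nu> times the bound for the skew part of the inverse; hence the factor
  \<open>card I\<close>.\<close>

lemma pminor_deriv_skew:
  fixes X N :: "real^'n::finite^'n"
  assumes acc: "accretive_mat \<kappa> \<delta> X" and "0 < \<kappa>" "0 < \<delta>" "\<delta> < 1"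
    and N: "skew_mat N" "\<And>\<xi>. norm (N *v \<xi>) \<le> \<nu> * norm \<xi>"
  shows "\<bar>pminor_deriv I X N\<bar> \<le> pminor I X * (card I * (\<delta> / ((1 + \<delta>\<^sup>2) * \<kappa>)) * \<nu>)"
proof -
  define c where "c = \<delta> / ((1 + \<delta>\<^sup>2) * \<kappa>)"
  have "0 \<le> c" using assms by (simp add: c_def)
  have acc': "accretive_mat \<kappa> \<delta> (minor_mat \<kappa> I X)" by (rule accretive_minor_mat[OF assms(1-3)])
  then obtain Y where Y: "minor_mat \<kappa> I X ** Y = mat 1"
    using accretive_inverse assms(2) by blast
  define N' where "N' = minor_mat 0 I N"
  have "skew_mat N'"
  proof -
    have "transpose N' $ i $ j = (- N') $ i $ j" for i j
      using skew_mat_nth[OF N(1), of i j] by (auto simp: transpose_def N'_def minor_mat_def)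
    then show ?thesis unfolding skew_mat_def vec_eq_iff by blast
  qed
  define h where "h i = axis i 1 \<bullet> (Y *v (N' *v axis i 1)) - (N' *v axis i 1) \<bullet> (Y *v axis i 1)" for i
  have h: "\<bar>h i\<bar> \<le> (if i \<in> I then 2 * c * \<nu> else 0)" for i
  proof (cases "i \<in> I")
    case True
    have N'_eq: "N' *v axis i 1 = restrict_vec I (N *v axis i 1)"
      using True by (simp add: matrix_vector_mult_basis N'_def minor_mat_def column_def restrict_vec_def vec_eq_iff)
    have "norm (N' *v axis i 1) \<le> norm (N *v axis i 1)"
      unfolding N'_eq by (rule norm_restrict_vec_le)
    also have "\<dots> \<le> \<nu>" using N(2)[of "axis i 1"] by (simp add: norm_axis_1)
    finally have "2 * c * norm (N' *v axis i 1) \<le> 2 * c * \<nu>"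
      using \<open>0 \<le> c\<close> by (intro mult_left_mono) auto
    moreover have "\<bar>h i\<bar> \<le> 2 * c * norm (N' *v axis i 1)"
      using skew_inverse_bound[OF acc' assms(2-4) Y, of "axis i 1" "N' *v axis i 1"]
      by (simp add: h_def c_def norm_axis_1 del: matrix_vector_mult_basis)
    ultimately show ?thesis using True by simp
  next
    case False
    have "N' *v axis i 1 = 0"
      using False by (auto simp: matrix_vector_mult_basis N'_def minor_mat_def column_def vec_eq_iff)
    then show ?thesis using False by (simp add: h_def)
  qed
  have "2 * \<bar>trace (Y ** N')\<bar> = \<bar>\<Sum>i\<in>UNIV. h i\<bar>"
    using trace_mult_skew[OF \<open>skew_mat N'\<close>, of Y] by (simp add: h_def del: matrix_vector_mult_basis)
  also have "\<dots> \<le> (\<Sum>i\<in>UNIV. if i \<in> I then 2 * c * \<nu> else 0)"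
    by (rule order_trans[OF sum_abs sum_mono]) (rule h)
  also have "\<dots> = 2 * (card I * c * \<nu>)" by (simp add: sum.If_cases)
  finally have "\<bar>trace (Y ** N')\<bar> \<le> card I * c * \<nu>" by simp
  moreover have pos: "0 < pminor I X" by (rule pminor_pos[OF assms(1-3)])
  ultimately have "pminor I X * \<bar>trace (Y ** N')\<bar> \<le> pminor I X * (card I * c * \<nu>)"
    by (intro mult_left_mono) auto
  moreover have "pminor_deriv I X N = pminor I X * trace (Y ** N')"
    using assms(2) by (simp add: pminor_deriv_eq_trace[OF _ Y] N'_def)
  ultimately show ?thesis using pos by (simp only: c_def abs_mult abs_of_pos)
qed

subsection \<open>The operator \<open>S_k\<close> on accretive matrices\<close>

definition S_k_deriv :: "nat \<Rightarrow> real^'n::finite^'n \<Rightarrow> real^'n^'n \<Rightarrow> real" where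
  "S_k_deriv k X M = (\<Sum>I | card I = k. pminor_deriv I X M)"

lemma S_k_has_real_derivative:
  fixes X M :: "real^'n::finite^'n"
  assumes "k \<le> CARD('n)"
  shows "((\<lambda>t. S_k k (X + t *\<^sub>R M)) has_real_derivative S_k_deriv k (X + t *\<^sub>R M) M) (at t)"
  unfolding S_k_eq_sum_pminor[OF assms] S_k_deriv_def
  by (intro DERIV_sum pminor_has_real_derivative)

lemma linear_S_k_deriv: "linear (S_k_deriv k X)"
  unfolding S_k_deriv_def
  by (intro linear_compose_sum ballI linear_pminor_deriv)

lemma exists_card_eq:
  assumes "k \<le> CARD('n::finite)"
  shows "\<exists>I :: 'n set. card I = k"
proof -
  obtain I :: "'n set" where "card I = k" using obtain_subset_with_card_n[OF assms] .
  then show ?thesis by blast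
qed

lemma S_k_pos:
  fixes X :: "real^'n::finite^'n"
  assumes "k \<le> CARD('n)" "accretive_mat \<kappa> \<delta> X" "0 < \<kappa>" "0 < \<delta>"
  shows "0 < S_k k X"
  unfolding S_k_eq_sum_pminor[OF assms(1)]
  by (rule sum_pos) (use exists_card_eq[OF assms(1)] pminor_pos[OF assms(2-4)] in auto)

lemma S_k_deriv_psd_nonneg:
  assumes "accretive_mat \<kappa> \<delta> X" "0 < \<kappa>" "0 < \<delta>" "psd M" "symmetric_mat M"
  shows "0 \<le> S_k_deriv k X M"
  unfolding S_k_deriv_def
  by (rule sum_nonneg, rule linear_nonneg_on_psd[OF linear_pminor_deriv pminor_deriv_outer(1)[OF assms(1-3)] assms(4,5)])

lemma S_k_deriv_outer_axis_pos:
  fixes X :: "real^'n::finite^'n"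
  assumes "accretive_mat \<kappa> \<delta> X" "0 < \<kappa>" "0 < \<delta>" "1 \<le> k" "k \<le> CARD('n)"
  shows "0 < S_k_deriv k X (outer (axis i 1))"
proof -
  \<comment> \<open>One positive summand suffices: an index set of size k through i, which exists
    because k is at least 1.\<close>
  obtain J :: "'n set" where J: "J \<subseteq> UNIV - {i}" "card J = k - 1"
    using obtain_subset_with_card_n[of "k - 1" "UNIV - {i}"] assms by (metis card_Diff_singleton diff_le_mono iso_tuple_UNIV_I)
  have "i \<notin> J" using J by auto
  then have "card (insert i J) = k" using J assms(4) by simp
  moreover have "restrict_vec (insert i J) (axis i 1) $ i \<noteq> 0" by (simp add: restrict_vec_def)
  then have "restrict_vec (insert i J) (axis i 1) \<noteq> 0" by (metis zero_index)
  ultimately show ?thesis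
    unfolding S_k_deriv_def
    by (intro sum_pos2[of _ "insert i J"]) (auto intro: pminor_deriv_outer[OF assms(1-3)])
qed

text \<open>All blocks have size k, so the relative bound is the same for every minor, and the
  positive weights \<open>pminor I X\<close> add up to \<open>S_k k X\<close>.\<close>

lemma S_k_deriv_skew:
  fixes X N :: "real^'n::finite^'n"
  assumes "accretive_mat \<kappa> \<delta> X" "0 < \<kappa>" "0 < \<delta>" "\<delta> < 1" "k \<le> CARD('n)"
    and "skew_mat N" "\<And>\<xi>. norm (N *v \<xi>) \<le> \<nu> * norm \<xi>"
  shows "\<bar>S_k_deriv k X N\<bar> \<le> S_k k X * (k * (\<delta> / ((1 + \<delta>\<^sup>2) * \<kappa>)) * \<nu>)"
proof -
  have "\<bar>S_k_deriv k X N\<bar> \<le> (\<Sum>I | card I = k. pminor I X * (k * (\<delta> / ((1 + \<delta>\<^sup>2) * \<kappa>)) * \<nu>))"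
    unfolding S_k_deriv_def using pminor_deriv_skew[OF assms(1-4,6,7)]
    by (intro order_trans[OF sum_abs sum_mono]) auto
  then show ?thesis by (simp only: S_k_eq_sum_pminor[OF assms(5)] sum_distrib_right)
qed

lemma convex_accretive: "convex {X. accretive_mat \<kappa> \<delta> X}"
proof (rule convexI, rule CollectI)
  fix X Z :: "real^'n::finite^'n" and a b :: real
  assume acc: "X \<in> {X. accretive_mat \<kappa> \<delta> X}" "Z \<in> {X. accretive_mat \<kappa> \<delta> X}" and ab: "0 \<le> a" "0 \<le> b" "a + b = 1"
  have inner: "\<xi> \<bullet> ((a *\<^sub>R X + b *\<^sub>R Z) *v \<eta>) = a * (\<xi> \<bullet> (X *v \<eta>)) + b * (\<xi> \<bullet> (Z *v \<eta>))" for \<xi> \<eta>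
    by (simp add: matrix_vector_mult_add_rdistrib scaleR_matrix_vector_assoc[symmetric] inner_add_right)
  show "accretive_mat \<kappa> \<delta> (a *\<^sub>R X + b *\<^sub>R Z)"
    unfolding accretive_mat_def inner
  proof (intro conjI allI)
    fix \<xi> \<eta> :: "real^'n"
    have "a * (\<kappa> * (\<xi> \<bullet> \<xi>)) + b * (\<kappa> * (\<xi> \<bullet> \<xi>)) \<le> a * (\<xi> \<bullet> (X *v \<xi>)) + b * (\<xi> \<bullet> (Z *v \<xi>))"
      using acc ab by (intro add_mono mult_left_mono) (auto simp: accretive_mat_def)
    then show "\<kappa> * (\<xi> \<bullet> \<xi>) \<le> a * (\<xi> \<bullet> (X *v \<xi>)) + b * (\<xi> \<bullet> (Z *v \<xi>))"
      using ab by (simp add: distrib_right[symmetric])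
    define c where "c = 2 * \<delta> * \<kappa> * norm \<xi> * norm \<eta>"
    have "\<bar>a * (\<xi> \<bullet> (X *v \<eta>) - \<eta> \<bullet> (X *v \<xi>)) + b * (\<xi> \<bullet> (Z *v \<eta>) - \<eta> \<bullet> (Z *v \<xi>))\<bar> \<le>
        a * \<bar>\<xi> \<bullet> (X *v \<eta>) - \<eta> \<bullet> (X *v \<xi>)\<bar> + b * \<bar>\<xi> \<bullet> (Z *v \<eta>) - \<eta> \<bullet> (Z *v \<xi>)\<bar>"
      using ab by (metis abs_mult abs_of_nonneg abs_triangle_ineq)
    also have "\<dots> \<le> a * c + b * c"
      using acc ab by (intro add_mono mult_left_mono) (auto simp: accretive_mat_def c_def)
    also have "\<dots> = c" using ab by (simp add: distrib_right[symmetric])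
    finally show "\<bar>a * (\<xi> \<bullet> (X *v \<eta>)) + b * (\<xi> \<bullet> (Z *v \<eta>)) - (a * (\<eta> \<bullet> (X *v \<xi>)) + b * (\<eta> \<bullet> (Z *v \<xi>)))\<bar> \<le> c"
      by (simp add: algebra_simps)
  qed
qed

section \<open>Mean value theorem and uniform constants\<close>

lemma ln_S_k_diff:
  fixes X Z :: "real^'n::finite^'n"
  assumes acc: "accretive_mat \<kappa> \<delta> X" "accretive_mat \<kappa> \<delta> Z" and pos: "0 < \<kappa>" "0 < \<delta>" and k: "k \<le> CARD('n)"
  obtains Y where "accretive_mat \<kappa> \<delta> Y" "norm Y \<le> max (norm X) (norm Z)"
    "ln (S_k k X) - ln (S_k k Z) = S_k_deriv k Y (X - Z) / S_k k Y"
proof -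
  define Y where "Y t = Z + t *\<^sub>R (X - Z)" for t
  have Y: "Y t = (1 - t) *\<^sub>R Z + t *\<^sub>R X" for t by (simp add: Y_def algebra_simps)
  have accY: "accretive_mat \<kappa> \<delta> (Y t)" if "0 \<le> t" "t \<le> 1" for t
    using convex_accretive[of \<kappa> \<delta>] acc that unfolding convex_alt Y by blast
  have "((\<lambda>t. ln (S_k k (Y t))) has_real_derivative S_k_deriv k (Y t) (X - Z) / S_k k (Y t)) (at t)"
    if "0 \<le> t" "t \<le> 1" for t
  proof -
    have "((\<lambda>t. S_k k (Y t)) has_real_derivative S_k_deriv k (Y t) (X - Z)) (at t)"
      unfolding Y_def by (rule S_k_has_real_derivative[OF k])
    from DERIV_chain2[where f = ln, OF DERIV_ln_divide[OF S_k_pos[OF k accY[OF that] pos]] this]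
    show ?thesis by simp
  qed
  then obtain t where t: "0 < t" "t < 1" "ln (S_k k (Y 1)) - ln (S_k k (Y 0)) = (1 - 0) * (S_k_deriv k (Y t) (X - Z) / S_k k (Y t))"
    using MVT2[of 0 1 "\<lambda>t. ln (S_k k (Y t))" "\<lambda>t. S_k_deriv k (Y t) (X - Z) / S_k k (Y t)"] zero_less_one by blast
  show ?thesis
  proof
    show "accretive_mat \<kappa> \<delta> (Y t)" using accY t by simp
    \<comment> \<open>This keeps the intermediate matrix, whose position is unknown, in a compact
      class fixed in advance.\<close>
    have "norm (Y t) \<le> (1 - t) * norm Z + t * norm X"
      unfolding Y using t by (intro order_trans[OF norm_triangle_ineq]) simp
    also have "\<dots> \<le> max (norm X) (norm Z)"
      using t by (intro convex_bound_le) auto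
    finally show "norm (Y t) \<le> max (norm X) (norm Z)" .
    show "ln (S_k k X) - ln (S_k k Z) = S_k_deriv k (Y t) (X - Z) / S_k k (Y t)"
      using t(3) by (simp add: Y_def)
  qed
qed

lemma compact_accretive: "compact {X :: real^'n::finite^'n. accretive_mat \<kappa> \<delta> X \<and> norm X \<le> \<Lambda>}"
proof -
  have cont: "continuous_on UNIV (\<lambda>X :: real^'n^'n. \<xi> \<bullet> (X *v \<eta>))" for \<xi> \<eta>
    unfolding matrix_vector_mult_def inner_vec_def by (intro continuous_intros)
  have "closed {X :: real^'n^'n. accretive_mat \<kappa> \<delta> X}"
    unfolding accretive_mat_def
    by (intro closed_Collect_conj closed_Collect_all closed_Collect_le continuous_intros cont)
  moreover have "{X :: real^'n^'n. accretive_mat \<kappa> \<delta> X \<and> norm X \<le> \<Lambda>} = cball 0 \<Lambda> \<inter> {X. accretive_mat \<kappa> \<delta> X}"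
    by auto
  ultimately show ?thesis by (simp add: compact_Int_closed)
qed

lemma continuous_on_S_k_deriv_ratio:
  assumes "k \<le> CARD('n)" "0 < \<kappa>" "0 < \<delta>" "\<And>X M. (X, M) \<in> S \<Longrightarrow> accretive_mat \<kappa> \<delta> X"
  shows "continuous_on S (\<lambda>(X :: real^'n::finite^'n, M). S_k_deriv k X M / S_k k X)"
proof -
  have "continuous_on S (\<lambda>z. S_k_deriv k (fst z) (snd z))"
    unfolding S_k_deriv_def using continuous_on_pminor_deriv[of S]
    by (intro continuous_on_sum) (simp add: case_prod_unfold)
  moreover have "continuous_on S (\<lambda>z. S_k k (fst z :: real^'n^'n))"
    unfolding S_k_eq_sum_pminor[OF assms(1)]
    by (intro continuous_on_sum continuous_on_compose2[OF continuous_on_pminor[of UNIV]] continuous_on_fst continuous_on_id) auto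
  ultimately show ?thesis
    unfolding case_prod_unfold using S_k_pos[OF assms(1) assms(4) assms(2,3)]
    by (intro continuous_on_divide) (auto simp: less_imp_neq[symmetric])
qed

text \<open>The ratio is continuous and homogeneous in M, so extrema over the compact class, with M
  fixed for \<theta> and on the unit sphere for C, are enough. Uniformity is essential, because
  \<alpha> is chosen from \<theta> and C before the minimum point is known.\<close>

lemma S_k_deriv_uniform_bounds:
  fixes i :: "'n::finite"
  assumes k: "1 \<le> k" "k \<le> CARD('n)" and pos: "0 < \<kappa>" "0 < \<delta>"
  obtains \<theta> C where "0 < \<theta>" "0 \<le> C"
    "\<And>X :: real^'n^'n. accretive_mat \<kappa> \<delta> X \<Longrightarrow> norm X \<le> \<Lambda> \<Longrightarrow> \<theta> \<le> S_k_deriv k X (outer (axis i 1)) / S_k k X"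
    "\<And>(X :: real^'n^'n) M. accretive_mat \<kappa> \<delta> X \<Longrightarrow> norm X \<le> \<Lambda> \<Longrightarrow> \<bar>S_k_deriv k X M / S_k k X\<bar> \<le> C * norm M"
proof (cases "{X :: real^'n^'n. accretive_mat \<kappa> \<delta> X \<and> norm X \<le> \<Lambda>} = {}")
  case True
  \<comment> \<open>In an empty class the bounds are vacuous; 1 and 0 are placeholders.\<close>
  then show ?thesis using that[of 1 0] by auto
next
  case False
  define K where "K = {X :: real^'n^'n. accretive_mat \<kappa> \<delta> X \<and> norm X \<le> \<Lambda>}"
  define g where "g = (\<lambda>(X :: real^'n^'n, M). S_k_deriv k X M / S_k k X)"
  have K: "compact K" "K \<noteq> {}" using False compact_accretive by (auto simp: K_def)
  have g: "continuous_on (K \<times> T) g" for T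
    unfolding g_def by (rule continuous_on_S_k_deriv_ratio[OF k(2) pos]) (auto simp: K_def)
  obtain z where z: "z \<in> K \<times> {outer (axis i 1)}" "\<And>y. y \<in> K \<times> {outer (axis i 1)} \<Longrightarrow> g z \<le> g y"
    using continuous_attains_inf[OF _ _ g, of "{outer (axis i 1)}"] K by (auto simp: compact_Times)
  have "0 < g z"
    using z(1) S_k_deriv_outer_axis_pos[OF _ pos k, of _ i] S_k_pos[OF k(2) _ pos]
    by (auto simp: g_def K_def)
  have "compact (g ` (K \<times> sphere 0 1))"
    by (intro compact_continuous_image g compact_Times K compact_sphere)
  then obtain C where C: "\<And>y. y \<in> g ` (K \<times> sphere 0 1) \<Longrightarrow> norm y \<le> C" "0 < C"
    using compact_imp_bounded bounded_pos by metis
  show ?thesis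
  proof (rule that[of "g z" C])
    show "0 < g z" by fact
    show "0 \<le> C" using C by simp
  next
    fix X :: "real^'n^'n"
    assume "accretive_mat \<kappa> \<delta> X" "norm X \<le> \<Lambda>"
    then show "g z \<le> S_k_deriv k X (outer (axis i 1)) / S_k k X"
      using z(2)[of "(X, outer (axis i 1))"] by (simp add: K_def g_def)
  next
    fix X M :: "real^'n^'n"
    assume X: "accretive_mat \<kappa> \<delta> X" "norm X \<le> \<Lambda>"
    have lin: "S_k_deriv k X (c *\<^sub>R M) = c * S_k_deriv k X M" for c
      using linear_scale[OF linear_S_k_deriv] by simp
    show "\<bar>S_k_deriv k X M / S_k k X\<bar> \<le> C * norm M"
    proof (cases "M = 0")
      case True
      then show ?thesis using lin[of 0] by simp
    next
      case False
      have "(X, (1 / norm M) *\<^sub>R M) \<in> K \<times> sphere 0 1" using X False by (simp add: K_def)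
      then have "\<bar>g (X, (1 / norm M) *\<^sub>R M)\<bar> \<le> C" using C(1) by (metis imageI real_norm_def)
      then have "\<bar>S_k_deriv k X M / S_k k X\<bar> / norm M \<le> C" by (simp add: g_def lin abs_mult mult.commute)
      moreover have "0 < norm M" using False by simp
      ultimately show ?thesis by (simp only: pos_divide_le_eq)
    qed
  qed
qed

subsection \<open>Eigenvalues, Hessians and interior minima\<close>

lemma norm_matrix_vector_mult_le:
  fixes M :: "real^'n::finite^'m::finite"
  shows "norm (M *v \<xi>) \<le> norm M * norm \<xi>"
proof -
  have "norm (M *v \<xi>) \<le> norm (\<chi> i. norm (M $ i) * norm \<xi>)"
    by (rule norm_le_componentwise_cart) (simp add: matrix_mult_dot Cauchy_Schwarz_ineq2)
  also have "\<dots> = norm M * norm \<xi>"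
    unfolding norm_vec_def[of M] norm_vec_def[of "\<chi> i. norm (M $ i) * norm \<xi>"]
    by (simp add: L2_set_left_distrib abs_mult)
  finally show ?thesis .
qed

lemma opnorm_le_norm: "opnorm M \<le> norm M"
  unfolding opnorm_def by (rule onorm_le) (rule norm_matrix_vector_mult_le)

lemma norm_mult_vec_le_opnorm: "norm (M *v \<xi>) \<le> opnorm M * norm \<xi>"
  unfolding opnorm_def by (intro onorm matrix_vector_mul_bounded_linear)

text \<open>\<open>Min\<close> in \<open>lambda_min\<close> is informative only for finite sets.
  Real eigenvalues are roots of the characteristic polynomial, hence values of
  \<open>eigvals M\<close>.\<close>

lemma finite_real_eigenvalues:
  fixes M :: "real^'n::finite^'n"
  shows "finite {t. \<exists>v. v \<noteq> 0 \<and> M *v v = t *\<^sub>R v}"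
proof -
  define ev where "ev = eigvals M"
  have ev: "det (mat t - cmat M) = (\<Prod>i\<in>UNIV. t - ev i)" for t
    unfolding ev_def eigvals_def using someI_ex[OF charpoly_splits[of M]] by blast
  have "complex_of_real t \<in> range ev" if "v \<noteq> 0" "M *v v = t *\<^sub>R v" for t v
  proof -
    have "(mat t - M) *v v = 0"
      using that by (simp add: matrix_vector_mult_diff_rdistrib) (simp add: matrix_vector_mult_def mat_def vec_eq_iff if_distrib if_distribR cong: if_cong)
    then have "det (mat t - M) = 0"
      using that(1) by (metis invertible_det_nz invertible_left_inverse matrix_left_invertible_ker)
    moreover have "mat (complex_of_real t) - cmat M = cmat (mat t - M)"
      by (simp add: cmat_def mat_def vec_eq_iff)
    ultimately have "det (mat (complex_of_real t) - cmat M) = 0"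
      by (metis pminor_cmat pminor_UNIV of_real_0)
    then show ?thesis by (auto simp: ev)
  qed
  then have "complex_of_real ` {t. \<exists>v. v \<noteq> 0 \<and> M *v v = t *\<^sub>R v} \<subseteq> range ev" by blast
  then have "finite (complex_of_real ` {t. \<exists>v. v \<noteq> 0 \<and> M *v v = t *\<^sub>R v})"
    by (rule finite_subset) simp
  then show ?thesis by (rule finite_imageD) (simp add: inj_on_def)
qed

text \<open>The minimum m of the quadratic form on the unit sphere is attained and is itself an
  eigenvalue, so it is at least \<open>lambda_min M\<close>.\<close>

lemma lambda_min_le_rayleigh:
  fixes M :: "real^'n::finite^'n"
  assumes "symmetric_mat M"
  shows "lambda_min M * (\<xi> \<bullet> \<xi>) \<le> \<xi> \<bullet> (M *v \<xi>)"
proof -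
  have cont: "continuous_on (sphere 0 1) (\<lambda>\<xi>. \<xi> \<bullet> (M *v \<xi>))"
    by (intro continuous_intros linear_continuous_on matrix_vector_mul_bounded_linear)
  have "axis undefined 1 \<in> sphere (0 :: real^'n) 1" by (simp add: norm_axis_1)
  then obtain v where v: "v \<in> sphere 0 1" "\<And>y. y \<in> sphere 0 1 \<Longrightarrow> v \<bullet> (M *v v) \<le> y \<bullet> (M *v y)"
    using continuous_attains_inf[OF compact_sphere _ cont] by blast
  define m where "m = v \<bullet> (M *v v)"
  have ray: "m * (\<xi> \<bullet> \<xi>) \<le> \<xi> \<bullet> (M *v \<xi>)" for \<xi>
  proof (cases "\<xi> = 0")
    case False
    have "m \<le> (\<xi> /\<^sub>R norm \<xi>) \<bullet> (M *v (\<xi> /\<^sub>R norm \<xi>))"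
      unfolding m_def using False by (intro v(2)) simp
    also have "\<dots> = (\<xi> \<bullet> (M *v \<xi>)) / (\<xi> \<bullet> \<xi>)"
      by (simp add: matrix_vector_mult_scaleR dot_square_norm power2_eq_square field_simps)
    finally show ?thesis using False by (simp add: pos_le_divide_eq)
  qed simp
  have mat_m: "mat m *v \<xi> = m *\<^sub>R \<xi>" for \<xi> :: "real^'n"
    by (simp add: matrix_vector_mult_def mat_def vec_eq_iff if_distrib if_distribR cong: if_cong)
  define N where "N = M - mat m"
  have N: "N *v \<xi> = M *v \<xi> - m *\<^sub>R \<xi>" for \<xi>
    by (simp add: N_def matrix_vector_mult_diff_rdistrib mat_m)
  have "psd N" unfolding psd_def N using ray by (simp add: inner_diff_right)
  moreover have "symmetric_mat N"
    using assms by (auto simp: symmetric_mat_def N_def transpose_def mat_def vec_eq_iff)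
  moreover have "v \<bullet> (N *v v) = 0"
    using v(1) by (simp add: N inner_diff_right m_def dot_square_norm)
  \<comment> \<open>The form of the semidefinite N vanishes at v; Cauchy-Schwarz against N v then
    forces N v = 0.\<close>
  ultimately have "((N *v v) \<bullet> (N *v v))\<^sup>2 \<le> 0"
    using psd_cauchy_schwarz[of N "N *v v" v] by simp
  then have "M *v v = m *\<^sub>R v" by (simp add: N)
  moreover have "v \<noteq> 0" using v(1) by auto
  ultimately have "m \<in> {t. \<exists>v. v \<noteq> 0 \<and> M *v v = t *\<^sub>R v}" by blast
  then have "lambda_min M \<le> m" unfolding lambda_min_def by (rule Min_le[OF finite_real_eigenvalues])
  then have "lambda_min M * (\<xi> \<bullet> \<xi>) \<le> m * (\<xi> \<bullet> \<xi>)" by (intro mult_right_mono) auto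
  then show ?thesis using ray[of \<xi>] by linarith
qed

text \<open>A nonsymmetric matrix may have no real eigenvalue, in which case
  \<^const>\<open>lambda_min\<close> is the junk value \<^term>\<open>Min {}\<close>.\<close>
lemma lambda_min_ge:
  fixes M :: "real^'n::finite^'n"
  shows "min (Min {}) (- norm M) \<le> lambda_min M"
proof (cases "{t. \<exists>v. v \<noteq> 0 \<and> M *v v = t *\<^sub>R v} = {}")
  case True
  then show ?thesis unfolding lambda_min_def by (simp only: min.cobounded1)
next
  case False
  then have "lambda_min M \<in> {t. \<exists>v. v \<noteq> 0 \<and> M *v v = t *\<^sub>R v}"
    unfolding lambda_min_def by (rule Min_in[OF finite_real_eigenvalues])
  then obtain v where v: "v \<noteq> 0" "M *v v = lambda_min M *\<^sub>R v" by blast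
  have "\<bar>lambda_min M\<bar> * norm v \<le> norm M * norm v"
    using norm_matrix_vector_mult_le[of M v] by (simp add: v(2))
  then have "\<bar>lambda_min M\<bar> \<le> norm M" using v(1) by simp
  then show ?thesis by linarith
qed

section \<open>Second differences and the second derivative test\<close>

lemma second_difference_approx:
  fixes u :: "real^'n::finite \<Rightarrow> real"
  assumes "open U" "x \<in> U"
    and u: "\<And>y. y \<in> U \<Longrightarrow> (u has_derivative (\<lambda>h. Du y \<bullet> h)) (at y)"
    and Du: "(Du has_derivative (\<lambda>h. H *v h)) (at x)"
    and "0 < e"
  obtains d where "0 < d" "\<And>s. 0 < s \<Longrightarrow> s < d \<Longrightarrow>
    \<bar>u (x + s *\<^sub>R \<xi> + s *\<^sub>R \<eta>) - u (x + s *\<^sub>R \<xi>) - u (x + s *\<^sub>R \<eta>) + u x - s\<^sup>2 * (\<xi> \<bullet> (H *v \<eta>))\<bar>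
      \<le> e * s\<^sup>2 * (2 * norm \<xi> + norm \<eta>) * norm \<xi>"
proof -
  obtain d1 where d1: "0 < d1" "ball x d1 \<subseteq> U" using assms(1,2) openE by blast
  have inU: "x + w \<in> U" if "norm w < d1" for w
    by (rule subsetD[OF d1(2)]) (simp add: dist_norm that)
  obtain d2 where d2: "0 < d2" "\<And>y. norm (y - x) < d2 \<Longrightarrow> norm (Du y - Du x - H *v (y - x)) \<le> e * norm (y - x)"
    using Du \<open>0 < e\<close> unfolding has_derivative_at_alt by blast
  define b where "b = norm \<xi> + norm \<eta> + 1"
  have "0 < b" by (simp add: b_def add_nonneg_pos)
  define d where "d = min d1 d2 / b"
  have "0 < d" using d1 d2 \<open>0 < b\<close> by (simp add: d_def)
  show ?thesis
  proof (rule that[OF \<open>0 < d\<close>])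
    fix s :: real assume s: "0 < s" "s < d"
    have sb: "s * b < min d1 d2" using s \<open>0 < b\<close> by (simp add: d_def pos_less_divide_eq)
    have sn: "s * (norm \<xi> + norm \<eta>) < s * b" using s by (simp add: b_def)
    have n1: "norm (t *\<^sub>R \<xi> + s *\<^sub>R \<eta>) \<le> s * (norm \<xi> + norm \<eta>)" if "0 \<le> t" "t \<le> s" for t
    proof -
      have "norm (t *\<^sub>R \<xi> + s *\<^sub>R \<eta>) \<le> t * norm \<xi> + s * norm \<eta>"
        using that s by (intro order_trans[OF norm_triangle_ineq]) simp
      also have "\<dots> \<le> s * norm \<xi> + s * norm \<eta>" using that by (simp add: mult_right_mono)
      finally show ?thesis by (simp add: distrib_left)
    qed
    have n2: "norm (t *\<^sub>R \<xi>) \<le> s * norm \<xi>" if "0 \<le> t" "t \<le> s" for t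
      using that by (simp add: mult_right_mono)
    have n2': "s * norm \<xi> \<le> s * (norm \<xi> + norm \<eta>)" using s by simp
    have small: "norm (t *\<^sub>R \<xi> + s *\<^sub>R \<eta>) < min d1 d2" "norm (t *\<^sub>R \<xi>) < min d1 d2" if "0 \<le> t" "t \<le> s" for t
      using n1[OF that] n2[OF that] n2' sn sb by linarith+
    \<comment> \<open>The second difference is g s - g 0. One mean value step leaves a difference of
      gradients, which differentiability of \<open>Du\<close> at the single point x
      controls.\<close>
    define g where "g t = u (x + t *\<^sub>R \<xi> + s *\<^sub>R \<eta>) - u (x + t *\<^sub>R \<xi>)" for t
    define g' where "g' t = Du (x + t *\<^sub>R \<xi> + s *\<^sub>R \<eta>) \<bullet> \<xi> - Du (x + t *\<^sub>R \<xi>) \<bullet> \<xi>" for t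
    have dg: "(g has_real_derivative g' t) (at t)" if "0 \<le> t" "t \<le> s" for t
    proof -
      have in1: "x + t *\<^sub>R \<xi> + s *\<^sub>R \<eta> \<in> U" and in2: "x + t *\<^sub>R \<xi> \<in> U"
        using inU[OF order_less_le_trans[OF small(1)[OF that] min.cobounded1]]
          inU[OF order_less_le_trans[OF small(2)[OF that] min.cobounded1]] by (simp_all only: add.assoc)
      have l1: "((\<lambda>t. x + t *\<^sub>R \<xi> + s *\<^sub>R \<eta>) has_derivative (\<lambda>h. h *\<^sub>R \<xi>)) (at t)"
        and l2: "((\<lambda>t. x + t *\<^sub>R \<xi>) has_derivative (\<lambda>h. h *\<^sub>R \<xi>)) (at t)"
        by (auto intro!: derivative_eq_intros)
      have "(g has_derivative (\<lambda>h. Du (x + t *\<^sub>R \<xi> + s *\<^sub>R \<eta>) \<bullet> (h *\<^sub>R \<xi>) - Du (x + t *\<^sub>R \<xi>) \<bullet> (h *\<^sub>R \<xi>))) (at t)"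
        unfolding g_def
        by (intro has_derivative_diff has_derivative_compose[OF l1 u[OF in1]] has_derivative_compose[OF l2 u[OF in2]])
      moreover have "(\<lambda>h. Du (x + t *\<^sub>R \<xi> + s *\<^sub>R \<eta>) \<bullet> (h *\<^sub>R \<xi>) - Du (x + t *\<^sub>R \<xi>) \<bullet> (h *\<^sub>R \<xi>)) = (*) (g' t)"
        by (rule ext) (simp add: g'_def algebra_simps)
      ultimately show ?thesis by (simp add: has_field_derivative_def)
    qed
    obtain t where t: "0 < t" "t < s" "g s - g 0 = (s - 0) * g' t"
      using MVT2[of 0 s g g'] s dg by blast
    have t': "0 \<le> t" "t \<le> s" using t by auto
    define r where "r y = Du y - Du x - H *v (y - x)" for y
    define y1 y2 where "y1 = x + t *\<^sub>R \<xi> + s *\<^sub>R \<eta>" and "y2 = x + t *\<^sub>R \<xi>"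
    have r1: "norm (r y1) \<le> e * (s * (norm \<xi> + norm \<eta>))"
    proof -
      have "norm (r y1) \<le> e * norm (t *\<^sub>R \<xi> + s *\<^sub>R \<eta>)"
        using d2(2)[of y1] small(1)[OF t'] by (simp add: r_def y1_def add.assoc)
      also have "\<dots> \<le> e * (s * (norm \<xi> + norm \<eta>))" using n1[OF t'] \<open>0 < e\<close> by (intro mult_left_mono) auto
      finally show ?thesis .
    qed
    have r2: "norm (r y2) \<le> e * (s * norm \<xi>)"
    proof -
      have "norm (r y2) \<le> e * norm (t *\<^sub>R \<xi>)"
        using d2(2)[of y2] small(2)[OF t'] by (simp add: r_def y2_def)
      also have "\<dots> \<le> e * (s * norm \<xi>)" using n2[OF t'] \<open>0 < e\<close> by (intro mult_left_mono) auto
      finally show ?thesis .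
    qed
    have "Du y1 - Du y2 = H *v (y1 - x) - H *v (y2 - x) + (r y1 - r y2)" by (simp add: r_def)
    also have "H *v (y1 - x) - H *v (y2 - x) = s *\<^sub>R (H *v \<eta>)"
      by (simp add: y1_def y2_def add.assoc matrix_vector_right_distrib matrix_vector_mult_scaleR)
    finally have Dy: "Du y1 - Du y2 = s *\<^sub>R (H *v \<eta>) + (r y1 - r y2)" .
    have "g' t = (Du y1 - Du y2) \<bullet> \<xi>" by (simp add: g'_def y1_def y2_def inner_diff_left)
    also have "\<dots> = s * (\<xi> \<bullet> (H *v \<eta>)) + (r y1 - r y2) \<bullet> \<xi>"
      unfolding Dy by (simp add: inner_add_left inner_add_right inner_commute)
    finally have g't: "g' t = s * (\<xi> \<bullet> (H *v \<eta>)) + (r y1 - r y2) \<bullet> \<xi>" .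
    have "g s - g 0 - s\<^sup>2 * (\<xi> \<bullet> (H *v \<eta>)) = s * ((r y1 - r y2) \<bullet> \<xi>)"
      unfolding t(3) g't by (simp add: power2_eq_square algebra_simps)
    moreover have "\<bar>s * ((r y1 - r y2) \<bullet> \<xi>)\<bar> \<le> s * ((e * (s * (norm \<xi> + norm \<eta>)) + e * (s * norm \<xi>)) * norm \<xi>)"
    proof -
      have "\<bar>(r y1 - r y2) \<bullet> \<xi>\<bar> \<le> norm (r y1 - r y2) * norm \<xi>" by (rule Cauchy_Schwarz_ineq2)
      also have "\<dots> \<le> (e * (s * (norm \<xi> + norm \<eta>)) + e * (s * norm \<xi>)) * norm \<xi>"
        using r1 r2 norm_triangle_ineq4[of "r y1" "r y2"] by (intro mult_right_mono) auto
      finally show ?thesis using s by (simp add: abs_mult)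
    qed
    moreover have "s * ((e * (s * (norm \<xi> + norm \<eta>)) + e * (s * norm \<xi>)) * norm \<xi>) = e * s\<^sup>2 * (2 * norm \<xi> + norm \<eta>) * norm \<xi>"
      by (simp add: power2_eq_square algebra_simps)
    ultimately show "\<bar>u (x + s *\<^sub>R \<xi> + s *\<^sub>R \<eta>) - u (x + s *\<^sub>R \<xi>) - u (x + s *\<^sub>R \<eta>) + u x - s\<^sup>2 * (\<xi> \<bullet> (H *v \<eta>))\<bar>
      \<le> e * s\<^sup>2 * (2 * norm \<xi> + norm \<eta>) * norm \<xi>"
      by (simp add: g_def algebra_simps)
  qed
qed

text \<open>The second difference is symmetric in its two directions. \<open>Hess\<close> is a
  choice without built-in symmetry, while the estimate by \<open>lambda_min\<close> requires
  it.\<close>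

lemma symmetric_hessian:
  fixes u :: "real^'n::finite \<Rightarrow> real"
  assumes "open U" "x \<in> U"
    and u: "\<And>y. y \<in> U \<Longrightarrow> (u has_derivative (\<lambda>h. Du y \<bullet> h)) (at y)"
    and Du: "(Du has_derivative (\<lambda>h. H *v h)) (at x)"
  shows "symmetric_mat H"
proof -
  have sym: "\<xi> \<bullet> (H *v \<eta>) = \<eta> \<bullet> (H *v \<xi>)" for \<xi> \<eta>
  proof (rule ccontr)
    define D where "D = \<bar>\<xi> \<bullet> (H *v \<eta>) - \<eta> \<bullet> (H *v \<xi>)\<bar>"
    assume "\<xi> \<bullet> (H *v \<eta>) \<noteq> \<eta> \<bullet> (H *v \<xi>)"
    then have "0 < D" by (simp add: D_def)
    define C where "C = (2 * norm \<xi> + norm \<eta>) * norm \<xi> + (2 * norm \<eta> + norm \<xi>) * norm \<eta> + 1"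
    have "0 < C" by (simp add: C_def add_nonneg_pos)
    \<comment> \<open>With this e the two errors together stay below s^2 D / 2.\<close>
    define e where "e = D / (2 * C)"
    have "0 < e" using \<open>0 < D\<close> \<open>0 < C\<close> by (simp add: e_def)
    obtain d1 where d1: "0 < d1" "\<And>s. 0 < s \<Longrightarrow> s < d1 \<Longrightarrow>
      \<bar>u (x + s *\<^sub>R \<xi> + s *\<^sub>R \<eta>) - u (x + s *\<^sub>R \<xi>) - u (x + s *\<^sub>R \<eta>) + u x - s\<^sup>2 * (\<xi> \<bullet> (H *v \<eta>))\<bar>
      \<le> e * s\<^sup>2 * (2 * norm \<xi> + norm \<eta>) * norm \<xi>"
      using second_difference_approx[OF assms \<open>0 < e\<close>, of \<xi> \<eta>] by blast
    obtain d2 where d2: "0 < d2" "\<And>s. 0 < s \<Longrightarrow> s < d2 \<Longrightarrow>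
      \<bar>u (x + s *\<^sub>R \<eta> + s *\<^sub>R \<xi>) - u (x + s *\<^sub>R \<eta>) - u (x + s *\<^sub>R \<xi>) + u x - s\<^sup>2 * (\<eta> \<bullet> (H *v \<xi>))\<bar>
      \<le> e * s\<^sup>2 * (2 * norm \<eta> + norm \<xi>) * norm \<eta>"
      using second_difference_approx[OF assms \<open>0 < e\<close>, of \<eta> \<xi>] by blast
    define s where "s = min d1 d2 / 2"
    have s: "0 < s" "s < d1" "s < d2" using d1(1) d2(1) by (auto simp: s_def)
    have eq: "x + s *\<^sub>R \<eta> + s *\<^sub>R \<xi> = x + s *\<^sub>R \<xi> + s *\<^sub>R \<eta>" by simp
    have "\<bar>s\<^sup>2 * (\<xi> \<bullet> (H *v \<eta>)) - s\<^sup>2 * (\<eta> \<bullet> (H *v \<xi>))\<bar> \<le>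
      e * s\<^sup>2 * (2 * norm \<xi> + norm \<eta>) * norm \<xi> + e * s\<^sup>2 * (2 * norm \<eta> + norm \<xi>) * norm \<eta>"
      using d1(2)[OF s(1,2)] d2(2)[OF s(1,3), unfolded eq] by linarith
    also have "\<dots> = s\<^sup>2 * (e * (C - 1))" by (simp add: C_def algebra_simps)
    finally have "s\<^sup>2 * D \<le> s\<^sup>2 * (e * (C - 1))"
      by (simp add: D_def right_diff_distrib[symmetric] abs_mult)
    then have "D \<le> e * (C - 1)" using s by simp
    also have "\<dots> < e * C" using \<open>0 < e\<close> by simp
    also have "\<dots> = D / 2" using \<open>0 < C\<close> by (simp add: e_def)
    finally show False using \<open>0 < D\<close> by simp
  qed
  have "H $ i $ j = H $ j $ i" for i j
    using sym[of "axis i 1" "axis j 1"]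
    by (simp add: inner_axis' matrix_vector_mult_basis column_def)
  then show ?thesis by (simp add: symmetric_mat_def transpose_def vec_eq_iff)
qed

text \<open>If the form were negative at some direction, the slope of W along it would turn negative
  right after x, and a mean value step would take W below its minimum.\<close>

lemma local_min_second_order:
  fixes W :: "real^'n::finite \<Rightarrow> real"
  assumes "0 < d"
    and W: "\<And>y. y \<in> ball x d \<Longrightarrow> (W has_derivative (\<lambda>h. DW y \<bullet> h)) (at y)"
    and DW: "(DW has_derivative (\<lambda>h. H *v h)) (at x)"
    and min: "\<And>y. y \<in> ball x d \<Longrightarrow> W x \<le> W y"
  shows "DW x = 0" "psd H"
proof -
  have "(\<lambda>h. DW x \<bullet> h) = (\<lambda>h. 0)"
    using assms(1) min by (intro differential_zero_maxmin[OF _ _ W, of x "ball x d"]) auto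
  then show DW0: "DW x = 0" by (metis inner_eq_zero_iff)
  show "psd H"
    unfolding psd_def
  proof (rule allI, rule ccontr)
    fix \<xi> assume neg: "\<not> 0 \<le> \<xi> \<bullet> (H *v \<xi>)"
    define g' where "g' t = DW (x + t *\<^sub>R \<xi>) \<bullet> \<xi>" for t
    have l: "((\<lambda>t. x + t *\<^sub>R \<xi>) has_derivative (\<lambda>h. h *\<^sub>R \<xi>)) (at t)" for t
      by (auto intro!: derivative_eq_intros)
    have "(g' has_derivative (\<lambda>h. (H *v (h *\<^sub>R \<xi>)) \<bullet> \<xi>)) (at 0)"
      unfolding g'_def using has_derivative_compose[OF l[of 0], of DW "\<lambda>h. H *v h"] DW
      by (intro has_derivative_inner_left) simp
    moreover have "(\<lambda>h. (H *v (h *\<^sub>R \<xi>)) \<bullet> \<xi>) = (*) (\<xi> \<bullet> (H *v \<xi>))"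
      by (rule ext) (simp add: matrix_vector_mult_scaleR inner_commute)
    ultimately have "(g' has_real_derivative \<xi> \<bullet> (H *v \<xi>)) (at 0)" by (simp add: has_field_derivative_def)
    then obtain c where c: "0 < c" "\<And>h. 0 < h \<Longrightarrow> h < c \<Longrightarrow> g' h < g' 0"
      using DERIV_neg_dec_right[of g' "\<xi> \<bullet> (H *v \<xi>)" 0] neg by auto
    have "g' 0 = 0" by (simp add: g'_def DW0)
    have "\<xi> \<noteq> 0" using neg by auto
    define s where "s = min c (d / norm \<xi>) / 2"
    have s: "0 < s" "s < c" "s * norm \<xi> < d"
      using c(1) assms(1) \<open>\<xi> \<noteq> 0\<close> by (auto simp: s_def min_def field_simps)
    have inb: "x + t *\<^sub>R \<xi> \<in> ball x d" if "0 \<le> t" "t \<le> s" for t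
    proof -
      have "t * norm \<xi> \<le> s * norm \<xi>" using that by (simp add: mult_right_mono)
      then show ?thesis using that s by (simp add: dist_norm)
    qed
    have "((\<lambda>t. W (x + t *\<^sub>R \<xi>)) has_real_derivative g' t) (at t)" if "0 \<le> t" "t \<le> s" for t
    proof -
      have "((\<lambda>t. W (x + t *\<^sub>R \<xi>)) has_derivative (\<lambda>h. DW (x + t *\<^sub>R \<xi>) \<bullet> (h *\<^sub>R \<xi>))) (at t)"
        by (rule has_derivative_compose[OF l W[OF inb[OF that]]])
      moreover have "(\<lambda>h. DW (x + t *\<^sub>R \<xi>) \<bullet> (h *\<^sub>R \<xi>)) = (*) (g' t)"
        by (rule ext) (simp add: g'_def)
      ultimately show ?thesis by (simp add: has_field_derivative_def)
    qed
    then obtain t where t: "0 < t" "t < s" "W (x + s *\<^sub>R \<xi>) - W (x + 0 *\<^sub>R \<xi>) = (s - 0) * g' t"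
      using MVT2[of 0 s "\<lambda>t. W (x + t *\<^sub>R \<xi>)" g'] s(1) by blast
    have "g' t < 0" using c(2)[of t] t s \<open>g' 0 = 0\<close> by simp
    then have "s * g' t < 0" using s(1) by (simp add: mult_pos_neg)
    then have "W (x + s *\<^sub>R \<xi>) < W x" using t(3) by simp
    moreover have "W x \<le> W (x + s *\<^sub>R \<xi>)" using s by (intro min inb) auto
    ultimately show False by simp
  qed
qed

subsection \<open>Regularity of the data and the inner normal\<close>

lemma C2_on_derivs:
  assumes "C2_on S u"
  shows "is_C2_derivs S u (Grad S u) (Hess S u)"
proof -
  have "\<exists>d. is_C2_derivs S u (fst d) (snd d)" using assms by (auto simp: C2_on_def)
  then show ?thesis unfolding Grad_def Hess_def by (rule someI_ex)
qed

lemma C1_on_imp_continuous_on: "C1_on S g \<Longrightarrow> continuous_on S g"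
  unfolding C1_on_def by (meson has_derivative_continuous_on)

lemma C1_on_ln:
  fixes g :: "'a::real_normed_vector \<Rightarrow> real"
  assumes "C1_on S g" "\<And>y. y \<in> S \<Longrightarrow> 0 < g y"
  shows "C1_on S (\<lambda>y. ln (g y))"
proof -
  obtain g' where g': "continuous_on S g'" "\<And>y. y \<in> S \<Longrightarrow> (g has_derivative blinfun_apply (g' y)) (at y within S)"
    using assms(1) by (auto simp: C1_on_def)
  have "((\<lambda>y. ln (g y)) has_derivative blinfun_apply (inverse (g y) *\<^sub>R g' y)) (at y within S)" if "y \<in> S" for y
    using that assms(2)[OF that] by (auto intro!: derivative_eq_intros g'(2) simp: scaleR_blinfun.rep_eq divide_inverse)
  moreover have "continuous_on S (\<lambda>y. inverse (g y) *\<^sub>R g' y)"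
    using assms(2) by (intro continuous_on_scaleR continuous_on_inverse C1_on_imp_continuous_on assms(1) g'(1)) fastforce
  ultimately show ?thesis unfolding C1_on_def by (intro exI[of _ "\<lambda>y. inverse (g y) *\<^sub>R g' y"]) blast
qed

text \<open>Even for x on the boundary the whole z-line through (x, z, p) lies in the domain, so the
  derivative within the domain restricts to a two-sided derivative in z.\<close>

lemma Dz_eq:
  assumes "((\<lambda>(x, z, p). F x z p) has_derivative g') (at (x, z, p) within dom_D \<Omega>)" "x \<in> closure \<Omega>"
  shows "((\<lambda>t. F x t p) has_vector_derivative g' (0, 1, 0)) (at z)" "Dz F x z p = g' (0, 1, 0)"
proof -
  have lin: "((\<lambda>t. (x, t, p)) has_derivative (\<lambda>h. (0, h, 0))) (at z)"
    by (auto intro!: derivative_eq_intros)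
  have sub: "(\<lambda>t. (x, t, p)) ` UNIV \<subseteq> dom_D \<Omega>" using assms(2) by (auto simp: dom_D_def)
  have "((\<lambda>t. F x t p) has_derivative (\<lambda>h. g' (0, h, 0))) (at z)"
    using diff_chain_within[OF lin has_derivative_subset[OF assms(1) sub]] by (simp add: o_def)
  moreover have "(\<lambda>h. g' (0, h, 0)) = (\<lambda>h. h *\<^sub>R g' (0, 1, 0))"
  proof
    fix h :: real
    have "linear g'" using assms(1) has_derivative_linear by blast
    then have "g' (h *\<^sub>R (0, 1, 0)) = h *\<^sub>R g' (0, 1, 0)" by (rule linear_scale)
    then show "g' (0, h, 0) = h *\<^sub>R g' (0, 1, 0)" by simp
  qed
  ultimately show *: "((\<lambda>t. F x t p) has_vector_derivative g' (0, 1, 0)) (at z)"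
    by (simp add: has_vector_derivative_def)
  show "Dz F x z p = g' (0, 1, 0)" unfolding Dz_def by (rule vector_derivative_at[OF *])
qed

lemma C1_on_Dz:
  assumes "C1_on (dom_D \<Omega>) (\<lambda>(x, z, p). F x z p)" "x \<in> closure \<Omega>"
  shows "((\<lambda>t. F x t p) has_vector_derivative Dz F x z p) (at z)"
proof -
  have "(x, z, p) \<in> dom_D \<Omega>" using assms(2) by (simp add: dom_D_def)
  then show ?thesis using assms Dz_eq by (metis C1_on_def)
qed

text \<open>The closure of \<Omega> may fail to be convex, but the ball of gradients is convex. The
  mean value inequality is applied in p alone, with the derivative bounded on a compact set of
  triples (x, z, p).\<close>

lemma C1_on_lipschitz_p:
  fixes F :: "real^'n::finite \<Rightarrow> real \<Rightarrow> real^'n \<Rightarrow> 'b::real_normed_vector"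
  assumes "C1_on (dom_D \<Omega>) (\<lambda>(x, z, p). F x z p)" "bounded \<Omega>"
  obtains L where "0 \<le> L" "\<And>x z p q. x \<in> closure \<Omega> \<Longrightarrow> \<bar>z\<bar> \<le> r \<Longrightarrow> norm p \<le> r \<Longrightarrow> norm q \<le> r \<Longrightarrow>
    norm (F x z p - F x z q) \<le> L * norm (p - q)"
proof -
  obtain g' where g': "continuous_on (dom_D \<Omega>) g'"
    "\<And>y. y \<in> dom_D \<Omega> \<Longrightarrow> ((\<lambda>(x, z, p). F x z p) has_derivative blinfun_apply (g' y)) (at y within dom_D \<Omega>)"
    using assms(1) by (auto simp: C1_on_def)
  define T where "T = closure \<Omega> \<times> cball (0::real) r \<times> cball (0::real^'n) r"
  have "compact T" unfolding T_def using assms(2) by (intro compact_Times compact_cball) simp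
  moreover have "T \<subseteq> dom_D \<Omega>" by (auto simp: T_def dom_D_def)
  ultimately have "bounded (g' ` T)"
    using g'(1) by (meson compact_continuous_image compact_imp_bounded continuous_on_subset)
  then obtain L where L: "0 < L" "\<And>y. y \<in> T \<Longrightarrow> norm (g' y) \<le> L" by (auto simp: bounded_pos)
  show ?thesis
  proof (rule that[of L])
    fix x :: "real^'n" and z :: real and p q :: "real^'n"
    assume a: "x \<in> closure \<Omega>" "\<bar>z\<bar> \<le> r" "norm p \<le> r" "norm q \<le> r"
    show "norm (F x z p - F x z q) \<le> L * norm (p - q)"
    proof (rule differentiable_bound[of "cball 0 r" "F x z" "\<lambda>p h. g' (x, z, p) (0, 0, h)"])
      fix y :: "real^'n" assume y: "y \<in> cball 0 r"
      have lin: "((\<lambda>y. (x, z, y)) has_derivative (\<lambda>h. (0, 0, h))) (at y within cball 0 r)"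
        by (auto intro!: derivative_eq_intros)
      have sub: "(\<lambda>y. (x, z, y)) ` cball 0 r \<subseteq> dom_D \<Omega>" using a(1) by (auto simp: dom_D_def)
      have "(x, z, y) \<in> dom_D \<Omega>" using a(1) by (simp add: dom_D_def)
      then show "(F x z has_derivative (\<lambda>h. g' (x, z, y) (0, 0, h))) (at y within cball 0 r)"
        using diff_chain_within[OF lin has_derivative_subset[OF g'(2) sub]] by (simp add: o_def)
      have "(x, z, y) \<in> T" using a y by (simp add: T_def)
      show "onorm (\<lambda>h. g' (x, z, y) (0, 0, h)) \<le> L"
      proof (rule onorm_le)
        fix h :: "real^'n"
        have "norm (g' (x, z, y) (0, 0, h)) \<le> norm (g' (x, z, y)) * norm (0::real^'n, 0::real, h)"
          by (rule norm_blinfun)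
        also have "\<dots> \<le> L * norm h" using L(2)[OF \<open>(x, z, y) \<in> T\<close>] by (simp add: norm_Pair mult_right_mono)
        finally show "norm (g' (x, z, y) (0, 0, h)) \<le> L * norm h" .
      qed
    qed (use a in \<open>auto simp: dist_norm\<close>)
  qed (use L in simp)
qed

text \<open>The two conditions decouple: the quadratic form of B vanishes, so W alone gives
  coercivity, and W cancels from the antisymmetrised form, so B alone gives the asymmetry.\<close>

lemma accretive_sub_skew:
  assumes "symmetric_mat W" "\<And>\<xi>. \<kappa> * (\<xi> \<bullet> \<xi>) \<le> \<xi> \<bullet> (W *v \<xi>)"
    and B: "skew_mat B" "\<And>\<xi>. norm (B *v \<xi>) \<le> \<delta> * \<kappa> * norm \<xi>"
  shows "accretive_mat \<kappa> \<delta> (W - B)"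
proof -
  have W: "\<xi> \<bullet> (W *v \<eta>) = \<eta> \<bullet> (W *v \<xi>)" for \<xi> \<eta>
    using inner_transpose_mult[of \<xi> W \<eta>] assms(1) by (metis symmetric_mat_def inner_commute)
  have Bs: "\<eta> \<bullet> (B *v \<xi>) = - (\<xi> \<bullet> (B *v \<eta>))" for \<xi> \<eta>
  proof -
    have "(- B) *v \<eta> = - (B *v \<eta>)" by (simp add: matrix_vector_mult_def vec_eq_iff sum_negf)
    moreover have "\<xi> \<bullet> ((- B) *v \<eta>) = (B *v \<xi>) \<bullet> \<eta>"
      using inner_transpose_mult[of \<xi> B \<eta>] B(1) by (simp only: skew_mat_def)
    ultimately show ?thesis by (simp add: inner_commute)
  qed
  have B0: "\<xi> \<bullet> (B *v \<xi>) = 0" for \<xi> using Bs[of \<xi> \<xi>] by simp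
  have "\<bar>\<xi> \<bullet> ((W - B) *v \<eta>) - \<eta> \<bullet> ((W - B) *v \<xi>)\<bar> \<le> 2 * \<delta> * \<kappa> * norm \<xi> * norm \<eta>" for \<xi> \<eta>
  proof -
    have "\<xi> \<bullet> ((W - B) *v \<eta>) - \<eta> \<bullet> ((W - B) *v \<xi>) = - 2 * (\<xi> \<bullet> (B *v \<eta>))"
      using W[of \<xi> \<eta>] Bs[of \<xi> \<eta>] by (simp add: matrix_vector_mult_diff_rdistrib inner_diff_right)
    then have "\<bar>\<xi> \<bullet> ((W - B) *v \<eta>) - \<eta> \<bullet> ((W - B) *v \<xi>)\<bar> = 2 * \<bar>\<xi> \<bullet> (B *v \<eta>)\<bar>" by simp
    also have "\<dots> \<le> 2 * (norm \<xi> * norm (B *v \<eta>))" by (simp add: Cauchy_Schwarz_ineq2)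
    also have "\<dots> \<le> 2 * (norm \<xi> * (\<delta> * \<kappa> * norm \<eta>))" using B(2)[of \<eta>] by (simp add: mult_left_mono)
    finally show ?thesis by (simp add: ac_simps)
  qed
  moreover have "\<kappa> * (\<xi> \<bullet> \<xi>) \<le> \<xi> \<bullet> ((W - B) *v \<xi>)" for \<xi>
    using assms(2)[of \<xi>] B0[of \<xi>] by (simp add: matrix_vector_mult_diff_rdistrib inner_diff_right)
  ultimately show ?thesis by (simp add: accretive_mat_def)
qed

lemma opnorm_le_mu:
  assumes "\<And>x z p. x \<in> closure \<Omega> \<Longrightarrow> opnorm (B x z p) \<le> b" "x \<in> closure \<Omega>"
  shows "opnorm (B x z p) \<le> mu \<Omega> B"
proof -
  have "bdd_above ((\<lambda>(x, z, p). opnorm (B x z p)) ` dom_D \<Omega>)"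
    using assms(1) by (intro bdd_aboveI[of _ b]) (auto simp: dom_D_def)
  moreover have "(x, z, p) \<in> dom_D \<Omega>" using assms(2) by (simp add: dom_D_def)
  ultimately show ?thesis
    unfolding mu_def using cSUP_upper[of "(x, z, p)" "dom_D \<Omega>" "\<lambda>(x, z, p). opnorm (B x z p)"] by simp
qed

text \<open>\<open>mu\<close> is a supremum over an unbounded set; boundedness of B and of its
  derivative makes it a genuine upper bound.\<close>

lemma BC1_on_opnorm_bounds:
  assumes "BC1_on (dom_D \<Omega>) (\<lambda>(x, z, p). B x z p)" "x \<in> closure \<Omega>"
  shows "opnorm (B x z p) \<le> mu \<Omega> B" "opnorm (Dz B x z p) \<le> mu \<Omega> (Dz B)"
proof -
  obtain g' where g': "bounded (g' ` dom_D \<Omega>)" "bounded ((\<lambda>(x, z, p). B x z p) ` dom_D \<Omega>)"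
    "\<And>y. y \<in> dom_D \<Omega> \<Longrightarrow> ((\<lambda>(x, z, p). B x z p) has_derivative blinfun_apply (g' y)) (at y within dom_D \<Omega>)"
    using assms(1) by (auto simp: BC1_on_def)
  obtain b where "\<forall>M\<in>(\<lambda>(x, z, p). B x z p) ` dom_D \<Omega>. norm M \<le> b"
    using g'(2) unfolding bounded_iff by blast
  from bspec[OF this imageI] have b: "norm (B x z p) \<le> b" if "(x, z, p) \<in> dom_D \<Omega>" for x z p
    using that by fastforce
  obtain b' where b': "\<And>y. y \<in> dom_D \<Omega> \<Longrightarrow> norm (g' y) \<le> b'"
    using g'(1) unfolding bounded_iff by auto
  show "opnorm (B x z p) \<le> mu \<Omega> B"
  proof (rule opnorm_le_mu[OF _ assms(2)])
    fix x z p assume "x \<in> closure \<Omega>"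
    then have "norm (B x z p) \<le> b" using b[of x z p] by (simp add: dom_D_def)
    then show "opnorm (B x z p) \<le> b" by (rule order_trans[OF opnorm_le_norm])
  qed
  show "opnorm (Dz B x z p) \<le> mu \<Omega> (Dz B)"
  proof (rule opnorm_le_mu[OF _ assms(2)])
    fix x z p assume x: "x \<in> closure \<Omega>"
    then have y: "(x, z, p) \<in> dom_D \<Omega>" by (simp add: dom_D_def)
    have "opnorm (Dz B x z p) \<le> norm (Dz B x z p)" by (rule opnorm_le_norm)
    also have "\<dots> = norm (g' (x, z, p) (0, 1, 0))" using Dz_eq(2)[OF g'(3)[OF y] x] by simp
    also have "\<dots> \<le> norm (g' (x, z, p)) * norm (0::real^'a, 1::real, 0::real^'a)" by (rule norm_blinfun)
    also have "\<dots> \<le> b'" using b'[OF y] by (simp add: norm_Pair)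
    finally show "opnorm (Dz B x z p) \<le> b'" .
  qed
qed

section \<open>One-sided derivatives and the inner normal\<close>

lemma inward_derivative_nonneg:
  fixes w :: "real^'n::finite \<Rightarrow> real"
  assumes w: "(w has_derivative (\<lambda>h. g \<bullet> h)) (at x within S)"
    and "0 < d" "\<And>t. 0 < t \<Longrightarrow> t < d \<Longrightarrow> x + t *\<^sub>R \<nu> \<in> S \<and> w x \<le> w (x + t *\<^sub>R \<nu>)"
  shows "0 \<le> g \<bullet> \<nu>"
proof (rule ccontr)
  assume neg: "\<not> 0 \<le> g \<bullet> \<nu>"
  then have "\<nu> \<noteq> 0" by auto
  define e where "e = - (g \<bullet> \<nu>) / (2 * norm \<nu>)"
  have "0 < e" using neg \<open>\<nu> \<noteq> 0\<close> by (simp add: e_def divide_neg_pos)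
  then obtain c where c: "0 < c" "\<And>y. y \<in> S \<Longrightarrow> norm (y - x) < c \<Longrightarrow> norm (w y - w x - g \<bullet> (y - x)) \<le> e * norm (y - x)"
    using w unfolding has_derivative_within_alt by blast
  define t where "t = min d (c / norm \<nu>) / 2"
  have t: "0 < t" "t < d" "t * norm \<nu> < c"
    using \<open>0 < d\<close> c(1) \<open>\<nu> \<noteq> 0\<close> by (auto simp: t_def min_def field_simps)
  have "norm (w (x + t *\<^sub>R \<nu>) - w x - g \<bullet> (t *\<^sub>R \<nu>)) \<le> e * (t * norm \<nu>)"
    using c(2)[of "x + t *\<^sub>R \<nu>"] assms(3)[OF t(1,2)] t by simp
  also have "e * (t * norm \<nu>) = - t * (g \<bullet> \<nu>) / 2" using \<open>\<nu> \<noteq> 0\<close> by (simp add: e_def)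
  finally have "w (x + t *\<^sub>R \<nu>) - w x \<le> t * (g \<bullet> \<nu>) / 2" by (simp add: abs_le_iff)
  also have "\<dots> < 0" using t(1) neg by (simp add: mult_pos_neg)
  finally show False using assms(3)[OF t(1,2)] by simp
qed

text \<open>The choice returns the normal of some defining function \<rho>. Its slope along that
  normal is minus the length of its gradient, so \<rho> drops below its boundary value 0, and
  \<Omega> is where \<rho> is negative.\<close>

lemma inner_normal_points_inward:
  fixes \<Omega> :: "(real^'n::finite) set"
  assumes "smooth_bounded_domain \<Omega>" "x \<in> frontier \<Omega>"
  obtains d where "0 < d" "\<And>t. 0 < t \<Longrightarrow> t < d \<Longrightarrow> x + t *\<^sub>R inner_normal \<Omega> x \<in> \<Omega>"
proof -
  define \<nu> where "\<nu> = inner_normal \<Omega> x"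
  have "\<exists>\<nu> \<rho>. defining_fun \<Omega> \<rho> \<and> \<nu> = - (inverse (norm (grad_fun \<rho> x))) *\<^sub>R grad_fun \<rho> x"
    using assms(1) by (auto simp: smooth_bounded_domain_def)
  from someI_ex[OF this] obtain \<rho> where
    \<rho>: "defining_fun \<Omega> \<rho>" "\<nu> = - (inverse (norm (grad_fun \<rho> x))) *\<^sub>R grad_fun \<rho> x"
    unfolding \<nu>_def inner_normal_def by blast
  define G where "G = grad_fun \<rho> x"
  have "pderivs [] \<rho> differentiable at x" using \<rho>(1) unfolding defining_fun_def smooth_fun_def by blast
  then have D: "(\<rho> has_derivative frechet_derivative \<rho> (at x)) (at x)"
    by (simp add: frechet_derivative_works[symmetric])
  have "frechet_derivative \<rho> (at x) \<nu> = G \<bullet> \<nu>"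
  proof -
    have lin: "linear (frechet_derivative \<rho> (at x))" using D has_derivative_linear by blast
    have "frechet_derivative \<rho> (at x) \<nu> = frechet_derivative \<rho> (at x) (\<Sum>i\<in>UNIV. \<nu> $ i *\<^sub>R axis i 1)"
      using basis_expansion[of \<nu>] by (simp add: scalar_mult_eq_scaleR)
    also have "\<dots> = (\<Sum>i\<in>UNIV. \<nu> $ i * frechet_derivative \<rho> (at x) (axis i 1))"
      by (simp add: linear_sum[OF lin] linear_scale[OF lin])
    finally show ?thesis by (simp add: G_def grad_fun_def partial_at_def inner_vec_def mult.commute)
  qed
  also have "G \<noteq> 0" "\<rho> x = 0" using \<rho>(1) assms(2) by (auto simp: defining_fun_def G_def)
  then have "G \<bullet> \<nu> < 0" by (simp add: \<rho>(2) G_def[symmetric] zero_less_mult_iff)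
  finally have neg: "frechet_derivative \<rho> (at x) \<nu> < 0" .
  have l: "((\<lambda>t. x + t *\<^sub>R \<nu>) has_derivative (\<lambda>h. h *\<^sub>R \<nu>)) (at 0)"
    by (auto intro!: derivative_eq_intros)
  have "((\<lambda>t. \<rho> (x + t *\<^sub>R \<nu>)) has_derivative (\<lambda>h. frechet_derivative \<rho> (at x) (h *\<^sub>R \<nu>))) (at 0)"
    using has_derivative_compose[OF l, of \<rho> "frechet_derivative \<rho> (at x)"] D by simp
  moreover have "(\<lambda>h. frechet_derivative \<rho> (at x) (h *\<^sub>R \<nu>)) = (*) (frechet_derivative \<rho> (at x) \<nu>)"
    using linear_scale[OF has_derivative_linear[OF D]] by (auto simp: mult.commute)
  ultimately have "((\<lambda>t. \<rho> (x + t *\<^sub>R \<nu>)) has_real_derivative frechet_derivative \<rho> (at x) \<nu>) (at 0)"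
    by (simp add: has_field_derivative_def)
  from DERIV_neg_dec_right[OF this neg] obtain d where
    d: "0 < d" "\<And>h. 0 < h \<Longrightarrow> h < d \<Longrightarrow> \<rho> (x + h *\<^sub>R \<nu>) < \<rho> x" by auto
  show ?thesis
    using d \<open>\<rho> x = 0\<close> \<rho>(1) by (intro that[OF d(1)]) (auto simp: defining_fun_def \<nu>_def)
qed

subsection \<open>The comparison principle\<close>

lemma exp_barrier_derivs:
  fixes \<alpha> :: real and i :: "'n::finite"
  shows "((\<lambda>x :: real^'n. exp (\<alpha> * x $ i)) has_derivative (\<lambda>h. ((\<alpha> * exp (\<alpha> * x $ i)) *\<^sub>R axis i 1) \<bullet> h)) (at x)"
    and "((\<lambda>x :: real^'n. (\<alpha> * exp (\<alpha> * x $ i)) *\<^sub>R axis i 1) has_derivative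
      (\<lambda>h. ((\<alpha>\<^sup>2 * exp (\<alpha> * x $ i)) *\<^sub>R outer (axis i 1)) *v h)) (at x)"
proof -
  have nth: "((\<lambda>x :: real^'n. x $ i) has_derivative (\<lambda>h. h $ i)) (at x)"
    by (rule bounded_linear_imp_has_derivative[OF bounded_linear_vec_nth])
  have e: "((\<lambda>x :: real^'n. exp (\<alpha> * x $ i)) has_derivative (\<lambda>h. \<alpha> * h $ i * exp (\<alpha> * x $ i))) (at x)"
    by (auto intro!: derivative_eq_intros nth)
  show "((\<lambda>x :: real^'n. exp (\<alpha> * x $ i)) has_derivative (\<lambda>h. ((\<alpha> * exp (\<alpha> * x $ i)) *\<^sub>R axis i 1) \<bullet> h)) (at x)"
    using e by (simp add: inner_axis' ac_simps)
  have eq: "((\<alpha>\<^sup>2 * exp (\<alpha> * x $ i)) *\<^sub>R outer (axis i 1)) *v h = (\<alpha> * (\<alpha> * h $ i * exp (\<alpha> * x $ i))) *\<^sub>R axis i 1" for h :: "real^'n"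
    by (simp add: scaleR_matrix_vector_assoc[symmetric] outer_mult_vec inner_axis' power2_eq_square ac_simps)
  show "((\<lambda>x :: real^'n. (\<alpha> * exp (\<alpha> * x $ i)) *\<^sub>R axis i 1) has_derivative
      (\<lambda>h. ((\<alpha>\<^sup>2 * exp (\<alpha> * x $ i)) *\<^sub>R outer (axis i 1)) *v h)) (at x)"
    unfolding eq by (intro has_derivative_scaleR_left has_derivative_mult_right e)
qed

lemma symmetric_mat_diff: "symmetric_mat M \<Longrightarrow> symmetric_mat N \<Longrightarrow> symmetric_mat (M - N)"
  by (simp add: symmetric_mat_def transpose_def vec_eq_iff)

lemma skew_mat_diff: "skew_mat M \<Longrightarrow> skew_mat N \<Longrightarrow> skew_mat (M - N)"
proof -
  assume "skew_mat M" "skew_mat N"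
  then have "transpose (M - N) $ i $ j = (- (M - N)) $ i $ j" for i j
    using skew_mat_nth[of M j i] skew_mat_nth[of N j i] by (simp add: transpose_def)
  then show ?thesis unfolding skew_mat_def vec_eq_iff by blast
qed

locale hessian_comparison =
  fixes \<Omega> :: "(real^'n::finite) set"
    and A B :: "real^'n \<Rightarrow> real \<Rightarrow> real^'n \<Rightarrow> real^'n^'n"
    and f :: "real^'n \<Rightarrow> real \<Rightarrow> real^'n \<Rightarrow> real"
    and u v :: "real^'n \<Rightarrow> real"
    and k :: nat and \<delta> \<beta> :: real
  assumes k: "1 \<le> k" "k \<le> CARD('n)"
    and dom: "open \<Omega>" "bounded \<Omega>"
    and A_C1: "C1_on (dom_D \<Omega>) (\<lambda>(x, z, p). A x z p)"
    and A_sym: "\<And>x z p. x \<in> closure \<Omega> \<Longrightarrow> symmetric_mat (A x z p)"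
    and f_C1: "C1_on (dom_D \<Omega>) (\<lambda>(x, z, p). f x z p)"
    and B_BC1: "BC1_on (dom_D \<Omega>) (\<lambda>(x, z, p). B x z p)"
    and B_skew: "\<And>x z p. x \<in> closure \<Omega> \<Longrightarrow> skew_mat (B x z p)"
    and \<delta>: "0 < \<delta>" "\<delta> < 1"
    and u_C2: "C2_on (closure \<Omega>) u"
    and v_C2: "C2_on (closure \<Omega>) v"
    and G_le: "\<And>x. x \<in> \<Omega> \<Longrightarrow> G_k k \<Omega> A B f u x \<le> G_k k \<Omega> A B f v x"
    and lambda_pos: "lambda_fun \<Omega> A u > 0" "lambda_fun \<Omega> A v > 0"
    and DzA: "\<And>x z p. x \<in> closure \<Omega> \<Longrightarrow> psd (Dz A x z p)"
    and mu_B: "mu \<Omega> B \<le> \<delta> * min (lambda_fun \<Omega> A u) (lambda_fun \<Omega> A v)"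
    and mu_DzB: "mu \<Omega> (Dz B) \<le> \<beta> * min (lambda_fun \<Omega> A u) (lambda_fun \<Omega> A v)"
    and f_pos: "\<And>x z p. x \<in> closure \<Omega> \<Longrightarrow> f x z p > 0"
    and Dzf: "\<And>x z p. x \<in> closure \<Omega> \<Longrightarrow> Dz f x z p / f x z p \<ge> k * \<delta> / (1 + \<delta>\<^sup>2) * \<beta>"
begin

abbreviation S where "S \<equiv> closure \<Omega>"

text \<open>One coercivity constant for both functions, so that R(x, u) and R(x, v) lie in the same
  convex class.\<close>

definition \<kappa> where "\<kappa> = min (lambda_fun \<Omega> A u) (lambda_fun \<Omega> A v)"

lemma \<kappa>_pos: "0 < \<kappa>" using lambda_pos by (simp add: \<kappa>_def)

lemma B_C1: "C1_on (dom_D \<Omega>) (\<lambda>(x, z, p). B x z p)"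
  using B_BC1 by (auto simp: BC1_on_def C1_on_def)

lemma norm_B_le: "x \<in> S \<Longrightarrow> norm (B x z p *v \<xi>) \<le> \<delta> * \<kappa> * norm \<xi>"
  using BC1_on_opnorm_bounds(1)[OF B_BC1, of x z p] mu_B norm_mult_vec_le_opnorm[of "B x z p" \<xi>]
  unfolding \<kappa>_def by (meson mult_right_mono norm_ge_zero order_trans)

lemma norm_DzB_le: "x \<in> S \<Longrightarrow> norm (Dz B x z p *v \<xi>) \<le> \<beta> * \<kappa> * norm \<xi>"
  using BC1_on_opnorm_bounds(2)[OF B_BC1, of x z p] mu_DzB norm_mult_vec_le_opnorm[of "Dz B x z p" \<xi>]
  unfolding \<kappa>_def by (meson mult_right_mono norm_ge_zero order_trans)

lemma continuous_on_jet:
  assumes "C1_on (dom_D \<Omega>) (\<lambda>(x, z, p). F x z p)" "C2_on S w"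
  shows "continuous_on S (\<lambda>x. F x (w x) (Grad S w x))"
proof -
  have "continuous_on S w" "continuous_on S (Grad S w)"
    using assms(2) C2_on_derivs[OF assms(2)] by (auto simp: C2_on_def is_C2_derivs_def)
  then have "continuous_on S (\<lambda>x. (x, w x, Grad S w x))" by (intro continuous_intros)
  from continuous_on_compose2[OF C1_on_imp_continuous_on[OF assms(1)] this]
  show ?thesis by (auto simp: dom_D_def)
qed

lemma continuous_on_omega:
  assumes "C2_on S w" shows "continuous_on S (omega_op \<Omega> A w)"
  using C2_on_derivs[OF assms] unfolding omega_op_def
  by (intro continuous_on_diff continuous_on_jet[OF A_C1 assms]) (auto simp: is_C2_derivs_def)

lemma bounded_jet:
  assumes "continuous_on S g" shows "\<exists>b. \<forall>x\<in>S. norm (g x) \<le> b"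
proof -
  have "bounded (g ` S)"
    using dom(2) assms by (intro compact_imp_bounded compact_continuous_image) auto
  then show ?thesis by (auto simp: bounded_iff)
qed

text \<open>An infimum is a lower bound only for a set bounded below. Symmetry of the Hessian is
  established in \<Omega> only, so on the boundary the crude bound \<open>lambda_min_ge\<close>,
  placeholder included, is used.\<close>

lemma lambda_fun_le:
  assumes "C2_on S w" "x \<in> S"
  shows "lambda_fun \<Omega> A w \<le> lambda_min (omega_op \<Omega> A w x)"
proof -
  obtain b where b: "\<forall>x\<in>S. norm (omega_op \<Omega> A w x) \<le> b"
    using bounded_jet[OF continuous_on_omega[OF assms(1)]] by blast
  have "bdd_below ((\<lambda>x. lambda_min (omega_op \<Omega> A w x)) ` S)"
  proof (rule bdd_belowI2)
    fix x assume "x \<in> S"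
    then show "min (Min {}) (- b) \<le> lambda_min (omega_op \<Omega> A w x)"
      using lambda_min_ge[of "omega_op \<Omega> A w x"] b by (smt (verit))
  qed
  then show ?thesis unfolding lambda_fun_def using assms(2) by (rule cINF_lower)
qed

lemma derivs_at:
  assumes "C2_on S w" "x \<in> \<Omega>"
  shows "(w has_derivative (\<lambda>h. Grad S w x \<bullet> h)) (at x)"
    "(Grad S w has_derivative (\<lambda>h. Hess S w x *v h)) (at x)"
proof -
  have "x \<in> interior S" using assms(2) dom(1) by (meson closure_subset interior_maximal subsetD)
  then have "at x within S = at x" by (rule at_within_interior)
  moreover have "x \<in> S" using assms(2) closure_subset by blast
  ultimately show "(w has_derivative (\<lambda>h. Grad S w x \<bullet> h)) (at x)"
    "(Grad S w has_derivative (\<lambda>h. Hess S w x *v h)) (at x)"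
    using C2_on_derivs[OF assms(1)] by (auto simp: is_C2_derivs_def)
qed

lemma symmetric_Hess:
  assumes "C2_on S w" "x \<in> \<Omega>" shows "symmetric_mat (Hess S w x)"
  by (rule symmetric_hessian[OF dom(1) assms(2) derivs_at(1)[OF assms(1)] derivs_at(2)[OF assms]])

lemma accretive_R:
  assumes "C2_on S w" "x \<in> \<Omega>" "\<kappa> \<le> lambda_fun \<Omega> A w"
  shows "accretive_mat \<kappa> \<delta> (R_op \<Omega> A B w x)"
proof -
  have x: "x \<in> S" using assms(2) closure_subset by blast
  have sym: "symmetric_mat (omega_op \<Omega> A w x)"
    unfolding omega_op_def by (intro symmetric_mat_diff symmetric_Hess assms(1,2) A_sym x)
  have "\<kappa> * (\<xi> \<bullet> \<xi>) \<le> \<xi> \<bullet> (omega_op \<Omega> A w x *v \<xi>)" for \<xi>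
  proof -
    have "\<kappa> * (\<xi> \<bullet> \<xi>) \<le> lambda_min (omega_op \<Omega> A w x) * (\<xi> \<bullet> \<xi>)"
      using assms(3) lambda_fun_le[OF assms(1) x] by (intro mult_right_mono) auto
    then show ?thesis using lambda_min_le_rayleigh[OF sym, of \<xi>] by linarith
  qed
  then show ?thesis
    unfolding R_op_def by (intro accretive_sub_skew sym B_skew norm_B_le x)
qed

section \<open>Increments of the data in z\<close>

lemma A_mono:
  assumes "x \<in> S" "z1 \<le> z2"
  shows "psd (A x z2 p - A x z1 p)"
  unfolding psd_def
proof
  fix \<xi>
  have "((\<lambda>t. \<xi> \<bullet> (A x t p *v \<xi>)) has_real_derivative \<xi> \<bullet> (Dz A x t p *v \<xi>)) (at t)" for t
  proof -
    have bl: "bounded_linear (\<lambda>M :: real^'n^'n. \<xi> \<bullet> (M *v \<xi>))"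
      by (auto intro!: linear_conv_bounded_linear[THEN iffD1] linearI
          simp: matrix_vector_mult_add_rdistrib inner_add_right scaleR_matrix_vector_assoc[symmetric])
    show ?thesis
      using bounded_linear.has_vector_derivative[OF bl C1_on_Dz[OF A_C1 assms(1)]]
      by (simp add: has_real_derivative_iff_has_vector_derivative)
  qed
  moreover have "0 \<le> \<xi> \<bullet> (Dz A x t p *v \<xi>)" for t
    using DzA[OF assms(1)] by (simp add: psd_def)
  ultimately have "\<xi> \<bullet> (A x z1 p *v \<xi>) \<le> \<xi> \<bullet> (A x z2 p *v \<xi>)"
    using DERIV_nonneg_imp_nondecreasing[OF assms(2), of "\<lambda>t. \<xi> \<bullet> (A x t p *v \<xi>)"] by blast
  then show "0 \<le> \<xi> \<bullet> ((A x z2 p - A x z1 p) *v \<xi>)"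
    by (simp add: matrix_vector_mult_diff_rdistrib inner_diff_right)
qed

lemma B_diff_le:
  assumes "x \<in> S" "z1 \<le> z2"
  shows "norm ((B x z2 p - B x z1 p) *v \<xi>) \<le> \<beta> * \<kappa> * (z2 - z1) * norm \<xi>"
proof -
  have bl: "bounded_linear (\<lambda>M :: real^'n^'n. M *v \<xi>)"
    by (auto intro!: linear_conv_bounded_linear[THEN iffD1] linearI
        simp: matrix_vector_mult_add_rdistrib scaleR_matrix_vector_assoc[symmetric])
  have "norm (B x z2 p *v \<xi> - B x z1 p *v \<xi>) \<le> \<beta> * \<kappa> * norm \<xi> * norm (z2 - z1)"
  proof (rule differentiable_bound[of UNIV "\<lambda>t. B x t p *v \<xi>" "\<lambda>t h. h *\<^sub>R (Dz B x t p *v \<xi>)"])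
    fix t :: real
    show "((\<lambda>t. B x t p *v \<xi>) has_derivative (\<lambda>h. h *\<^sub>R (Dz B x t p *v \<xi>))) (at t)"
      using bounded_linear.has_vector_derivative[OF bl C1_on_Dz[OF B_C1 assms(1)]]
      by (simp add: has_vector_derivative_def)
    show "onorm (\<lambda>h. h *\<^sub>R (Dz B x t p *v \<xi>)) \<le> \<beta> * \<kappa> * norm \<xi>"
    proof (rule onorm_le)
      fix h :: real
      show "norm (h *\<^sub>R (Dz B x t p *v \<xi>)) \<le> \<beta> * \<kappa> * norm \<xi> * norm h"
        using mult_left_mono[OF norm_DzB_le[OF assms(1), of t p \<xi>], of "\<bar>h\<bar>"] by (simp add: ac_simps)
    qed
  qed auto
  then show ?thesis using assms(2) by (simp add: matrix_vector_mult_diff_rdistrib ac_simps)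
qed

lemma ln_f_C1: "C1_on (dom_D \<Omega>) (\<lambda>(x, z, p). ln (f x z p))"
  using C1_on_ln[OF f_C1] f_pos by (auto simp: dom_D_def case_prod_unfold)

lemma ln_f_diff_ge:
  assumes "x \<in> S" "z1 < z2"
  shows "k * \<delta> / (1 + \<delta>\<^sup>2) * \<beta> * (z2 - z1) \<le> ln (f x z2 p) - ln (f x z1 p)"
proof -
  have "((\<lambda>t. ln (f x t p)) has_real_derivative Dz f x t p / f x t p) (at t)" for t
  proof -
    have "((\<lambda>t. f x t p) has_real_derivative Dz f x t p) (at t)"
      using C1_on_Dz[OF f_C1 assms(1)] by (simp add: has_real_derivative_iff_has_vector_derivative)
    from DERIV_chain2[where f = ln, OF DERIV_ln_divide[OF f_pos[OF assms(1)]] this]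
    show ?thesis by simp
  qed
  then obtain t where "ln (f x z2 p) - ln (f x z1 p) = (z2 - z1) * (Dz f x t p / f x t p)"
    using MVT2[OF assms(2), of "\<lambda>t. ln (f x t p)" "\<lambda>t. Dz f x t p / f x t p"] by blast
  moreover have "(z2 - z1) * (k * \<delta> / (1 + \<delta>\<^sup>2) * \<beta>) \<le> (z2 - z1) * (Dz f x t p / f x t p)"
    using Dzf[OF assms(1)] assms(2) by (intro mult_left_mono) auto
  ultimately show ?thesis by (simp add: mult.commute)
qed

text \<open>At a point where the perturbed difference has a vanishing gradient and a positive
  semidefinite Hessian, the ellipticity \<open>\<theta>\<close> bounds the size \<open>a\<close> of the rank-one perturbation by that
  of the gradient perturbation: the zeroth order terms of \<open>A\<close>, \<open>B\<close> and \<open>f\<close> have the right sign.\<close>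
lemma perturbation_bound:
  assumes x: "x \<in> \<Omega>" and neg: "u x < v x" and pos: "0 \<le> a" "0 \<le> C"
    and psd: "psd (Hess S u x - Hess S v x - a *\<^sub>R outer (axis i 1))"
    and \<theta>: "\<And>X :: real^'n^'n. accretive_mat \<kappa> \<delta> X \<Longrightarrow> norm X \<le> \<Lambda> \<Longrightarrow> \<theta> \<le> S_k_deriv k X (outer (axis i 1)) / S_k k X"
    and C: "\<And>(X :: real^'n^'n) M. accretive_mat \<kappa> \<delta> X \<Longrightarrow> norm X \<le> \<Lambda> \<Longrightarrow> \<bar>S_k_deriv k X M / S_k k X\<bar> \<le> C * norm M"
    and \<Lambda>: "norm (R_op \<Omega> A B u x) \<le> \<Lambda>" "norm (R_op \<Omega> A B v x) \<le> \<Lambda>"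
    and A: "norm (A x (v x) (Grad S u x) - A x (v x) (Grad S v x)) \<le> L * e"
    and B: "norm (B x (v x) (Grad S u x) - B x (v x) (Grad S v x)) \<le> L * e"
    and f: "\<bar>ln (f x (v x) (Grad S u x)) - ln (f x (v x) (Grad S v x))\<bar> \<le> L * e"
  shows "a * \<theta> \<le> (2 * C + 1) * L * e"
proof -
  have xS: "x \<in> S" using x closure_subset by blast
  define p q where "p = Grad S u x" and "q = Grad S v x"
  define zu zv where "zu = u x" and "zv = v x"
  define c where "c = k * \<delta> / (1 + \<delta>\<^sup>2) * \<beta>"
  define Ru Rv where "Ru = R_op \<Omega> A B u x" and "Rv = R_op \<Omega> A B v x"
  have acc: "accretive_mat \<kappa> \<delta> Ru" "accretive_mat \<kappa> \<delta> Rv"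
    unfolding Ru_def Rv_def by (intro accretive_R u_C2 v_C2 x; simp add: \<kappa>_def)+
  obtain Y where Y: "accretive_mat \<kappa> \<delta> Y" "norm Y \<le> max (norm Ru) (norm Rv)"
    and lnY: "ln (S_k k Ru) - ln (S_k k Rv) = S_k_deriv k Y (Ru - Rv) / S_k k Y"
    using ln_S_k_diff[OF acc \<kappa>_pos \<delta>(1) k(2)] by blast
  have Y\<Lambda>: "norm Y \<le> \<Lambda>" using Y(2) \<Lambda> by (simp add: Ru_def Rv_def)
  have SY: "0 < S_k k Y" by (rule S_k_pos[OF k(2) Y(1) \<kappa>_pos \<delta>(1)])
  define D where "D M = S_k_deriv k Y M / S_k k Y" for M
  have D_add: "D (M + N) = D M + D N" for M N
    using linear_add[OF linear_S_k_deriv[of k Y]] by (simp add: D_def add_divide_distrib)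
  have D_scale: "D (t *\<^sub>R M) = t * D M" for t M
    using linear_scale[OF linear_S_k_deriv[of k Y]] by (simp add: D_def)
  have D_psd: "0 \<le> D M" if "psd M" "symmetric_mat M" for M
    unfolding D_def using S_k_deriv_psd_nonneg[OF Y(1) \<kappa>_pos \<delta>(1) that] SY by simp
  define M1 where "M1 = Hess S u x - Hess S v x - a *\<^sub>R outer (axis i 1)"
  \<comment> \<open>The path from (u, Du) to (v, Dv) changes z first, with p = Du fixed, and then p
    at z = v. The same path is used for A, B and log f, so that their z-increments refer to the same
    p.\<close>
  define MA where "MA = A x zv p - A x zu p"
  define MA' where "MA' = A x zv q - A x zv p"
  define MB where "MB = B x zv p - B x zu p"
  define MB' where "MB' = B x zv q - B x zv p"
  have "Ru - Rv = M1 + a *\<^sub>R outer (axis i 1) + MA + MA' + MB + MB'"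
    by (simp add: Ru_def Rv_def R_op_def omega_op_def M1_def MA_def MA'_def MB_def MB'_def p_def q_def zu_def zv_def)
  then have split: "D (Ru - Rv) = D M1 + a * D (outer (axis i 1)) + D MA + D MA' + D MB + D MB'"
    by (simp only: D_add D_scale)
  have "0 \<le> D M1"
  proof (rule D_psd)
    show "psd M1" unfolding M1_def by (rule psd)
    have "symmetric_mat (a *\<^sub>R outer (axis i 1 :: real^'n))"
      by (simp add: symmetric_mat_def outer_def transpose_def vec_eq_iff mult.commute)
    then show "symmetric_mat M1"
      unfolding M1_def by (intro symmetric_mat_diff symmetric_Hess u_C2 v_C2 x)
  qed
  moreover have "a * \<theta> \<le> a * D (outer (axis i 1))"
    unfolding D_def using \<theta>[OF Y(1) Y\<Lambda>] pos(1) by (intro mult_left_mono)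
  moreover have "0 \<le> D MA"
    unfolding MA_def using neg by (intro D_psd symmetric_mat_diff A_sym xS A_mono) (simp add: zu_def zv_def)
  moreover have "\<bar>D MA'\<bar> \<le> C * (L * e)"
    unfolding D_def MA'_def p_def q_def zv_def
    using order_trans[OF C[OF Y(1) Y\<Lambda>] mult_left_mono[OF _ pos(2)]] A by (simp add: norm_minus_commute)
  moreover have "\<bar>D MB'\<bar> \<le> C * (L * e)"
    unfolding D_def MB'_def p_def q_def zv_def
    using order_trans[OF C[OF Y(1) Y\<Lambda>] mult_left_mono[OF _ pos(2)]] B by (simp add: norm_minus_commute)
  moreover have "\<bar>D MB\<bar> \<le> c * (zv - zu)"
  proof -
    have "\<bar>S_k_deriv k Y MB\<bar> \<le> S_k k Y * (k * (\<delta> / ((1 + \<delta>\<^sup>2) * \<kappa>)) * (\<beta> * \<kappa> * (zv - zu)))"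
      unfolding MB_def using neg
      by (intro S_k_deriv_skew Y(1) \<kappa>_pos \<delta> k(2) skew_mat_diff B_skew xS B_diff_le) (simp add: zu_def zv_def)
    \<comment> \<open>The \<kappa> from the z-derivative of B cancels the one from the inverse; what
      is left is the constant of (vii).\<close>
    also have "k * (\<delta> / ((1 + \<delta>\<^sup>2) * \<kappa>)) * (\<beta> * \<kappa> * (zv - zu)) = c * (zv - zu)"
      using \<kappa>_pos by (simp add: c_def)
    finally show ?thesis using SY by (simp add: D_def pos_divide_le_eq mult.commute)
  qed
  moreover have "c * (zv - zu) \<le> ln (f x zv p) - ln (f x zu p)"
    unfolding c_def using neg by (intro ln_f_diff_ge xS) (simp add: zu_def zv_def)
  moreover have "\<bar>ln (f x zv p) - ln (f x zv q)\<bar> \<le> L * e"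
    using f by (simp add: zv_def p_def q_def)
  moreover have "D (Ru - Rv) \<le> ln (f x zu p) - ln (f x zv q)"
    using G_le[OF x] lnY by (simp add: G_k_def D_def Ru_def Rv_def zu_def zv_def p_def q_def)
  \<comment> \<open>The possible loss c (zv - zu) from MB is matched by the gain of log f in z, so
    only the three gradient increments remain on the right.\<close>
  ultimately have "a * \<theta> \<le> C * (L * e) + C * (L * e) + L * e"
    using split by linarith
  then show ?thesis by (simp add: algebra_simps)
qed

lemma comparison:
  assumes bd: "\<And>x. x \<in> frontier \<Omega> \<Longrightarrow> v x \<le> u x" and "x \<in> \<Omega>"
  shows "v x \<le> u x"
proof (rule ccontr)
  assume "\<not> v x \<le> u x"
  define i where "i = (undefined :: 'n)"
  have cont: "continuous_on S u" "continuous_on S v" "continuous_on S (Grad S u)" "continuous_on S (Grad S v)"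
    using u_C2 v_C2 C2_on_derivs[OF u_C2] C2_on_derivs[OF v_C2] by (auto simp: C2_on_def is_C2_derivs_def)
  have "continuous_on S (R_op \<Omega> A B w)" if "C2_on S w" for w
    unfolding R_op_def by (intro continuous_on_diff continuous_on_omega continuous_on_jet[OF B_C1] that)
  then obtain \<Lambda>u \<Lambda>v where \<Lambda>: "\<forall>x\<in>S. norm (R_op \<Omega> A B u x) \<le> \<Lambda>u" "\<forall>x\<in>S. norm (R_op \<Omega> A B v x) \<le> \<Lambda>v"
    using bounded_jet[of "R_op \<Omega> A B u"] bounded_jet[of "R_op \<Omega> A B v"] u_C2 v_C2 by blast
  define \<Lambda> where "\<Lambda> = max \<Lambda>u \<Lambda>v"
  obtain ru rv rz where r: "\<forall>x\<in>S. norm (Grad S u x) \<le> ru" "\<forall>x\<in>S. norm (Grad S v x) \<le> rv" "\<forall>x\<in>S. norm (v x) \<le> rz"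
    using bounded_jet[OF cont(3)] bounded_jet[OF cont(4)] bounded_jet[OF cont(2)] by blast
  \<comment> \<open>A radius for every jet that is compared: z is a value of v, and p is a gradient
    of u or of v.\<close>
  define r where "r = max ru (max rv rz)"
  obtain \<theta> C where \<theta>C: "0 < \<theta>" "0 \<le> C"
    "\<And>X :: real^'n^'n. accretive_mat \<kappa> \<delta> X \<Longrightarrow> norm X \<le> \<Lambda> \<Longrightarrow> \<theta> \<le> S_k_deriv k X (outer (axis i 1)) / S_k k X"
    "\<And>(X :: real^'n^'n) M. accretive_mat \<kappa> \<delta> X \<Longrightarrow> norm X \<le> \<Lambda> \<Longrightarrow> \<bar>S_k_deriv k X M / S_k k X\<bar> \<le> C * norm M"
    using S_k_deriv_uniform_bounds[OF k \<kappa>_pos \<delta>(1), of \<Lambda> i] by blast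
  obtain LA where LA: "0 \<le> LA" "\<And>x z p q. x \<in> S \<Longrightarrow> \<bar>z\<bar> \<le> r \<Longrightarrow> norm p \<le> r \<Longrightarrow> norm q \<le> r \<Longrightarrow>
    norm (A x z p - A x z q) \<le> LA * norm (p - q)"
    using C1_on_lipschitz_p[OF A_C1 dom(2), of r] by blast
  obtain LB where LB: "0 \<le> LB" "\<And>x z p q. x \<in> S \<Longrightarrow> \<bar>z\<bar> \<le> r \<Longrightarrow> norm p \<le> r \<Longrightarrow> norm q \<le> r \<Longrightarrow>
    norm (B x z p - B x z q) \<le> LB * norm (p - q)"
    using C1_on_lipschitz_p[OF B_C1 dom(2), of r] by blast
  obtain Lf where Lf: "0 \<le> Lf" "\<And>x z p q. x \<in> S \<Longrightarrow> \<bar>z\<bar> \<le> r \<Longrightarrow> norm p \<le> r \<Longrightarrow> norm q \<le> r \<Longrightarrow>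
    norm (ln (f x z p) - ln (f x z q)) \<le> Lf * norm (p - q)"
    using C1_on_lipschitz_p[OF ln_f_C1 dom(2), of r] by blast
  define L where "L = max LA (max LB Lf)"
  \<comment> \<open>Chosen so that \<alpha> \<theta> exceeds (2 C + 1) L by 1. The order of choice
    matters: \<theta>, C and L depend on neither \<alpha> nor \<epsilon>, H depends on \<alpha>, and
    \<epsilon> comes last.\<close>
  define \<alpha> where "\<alpha> = ((2 * C + 1) * L + 1) / \<theta>"
  have "0 \<le> L" using LA(1) by (simp add: L_def)
  then have "0 < \<alpha>" using \<theta>C(1,2) by (simp add: \<alpha>_def add_nonneg_pos)
  define h where "h y = exp (\<alpha> * y $ i)" for y :: "real^'n"
  have "continuous_on S h" unfolding h_def by (intro continuous_intros)
  then obtain H where H: "\<forall>y\<in>S. norm (h y) \<le> H" using bounded_jet by blast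
  have xS: "x \<in> S" using \<open>x \<in> \<Omega>\<close> closure_subset by blast
  have hpos: "0 < h y" for y by (simp add: h_def)
  have "0 < H" using H xS hpos[of x] by force
  \<comment> \<open>The barrier shifts values by at most half of the gap v - u at x, so u < v
    persists at the minimum point of W, and that point cannot lie on the boundary.\<close>
  define \<epsilon> where "\<epsilon> = (v x - u x) / (2 * H)"
  have \<epsilon>: "0 < \<epsilon>" "\<epsilon> * H < v x - u x" using \<open>\<not> v x \<le> u x\<close> \<open>0 < H\<close> by (auto simp: \<epsilon>_def)
  \<comment> \<open>The barrier is subtracted: at a minimum of W the Hessian of u - v then dominates
    the positive rank-one matrix \<epsilon> D^2 h.\<close>
  define W where "W y = u y - v y - \<epsilon> * h y" for y
  have "continuous_on S W" unfolding W_def h_def by (intro continuous_intros cont)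
  moreover have "compact S" "S \<noteq> {}" using dom(2) xS by auto
  ultimately have "\<exists>y\<in>S. \<forall>y'\<in>S. W y \<le> W y'" by (intro continuous_attains_inf)
  then obtain y where y: "y \<in> S" "\<And>y'. y' \<in> S \<Longrightarrow> W y \<le> W y'" by blast
  have \<epsilon>h: "\<epsilon> * h y \<le> \<epsilon> * H" using H y(1) \<epsilon>(1) by (intro mult_left_mono) auto
  have "W y \<le> W x" by (rule y(2)[OF xS])
  also have "W x < u x - v x" using \<epsilon>(1) hpos[of x] by (simp add: W_def)
  finally have Wy: "W y < u x - v x" .
  then have neg: "u y < v y" using \<epsilon>h \<epsilon>(2) by (simp add: W_def)
  then have "y \<notin> frontier \<Omega>" using bd[of y] by auto
  then have y\<Omega>: "y \<in> \<Omega>" using y(1) dom(1) by (simp add: frontier_def interior_open)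
  obtain d where d: "0 < d" "ball y d \<subseteq> \<Omega>" using dom(1) y\<Omega> openE by blast
  define DW where "DW z = Grad S u z - Grad S v z - \<epsilon> *\<^sub>R ((\<alpha> * h z) *\<^sub>R axis i 1)" for z
  define a where "a = \<epsilon> * (\<alpha>\<^sup>2 * h y)"
  have W': "(W has_derivative (\<lambda>k. DW z \<bullet> k)) (at z)" if "z \<in> ball y d" for z
  proof -
    have z: "z \<in> \<Omega>" using that d(2) by blast
    have "(W has_derivative (\<lambda>k. Grad S u z \<bullet> k - Grad S v z \<bullet> k - \<epsilon> * (((\<alpha> * h z) *\<^sub>R axis i 1) \<bullet> k))) (at z)"
      unfolding W_def h_def
      by (intro has_derivative_diff has_derivative_mult_right derivs_at u_C2 v_C2 z exp_barrier_derivs)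
    then show ?thesis by (simp add: DW_def inner_diff_left mult.assoc)
  qed
  have DW': "(DW has_derivative (\<lambda>k. (Hess S u y - Hess S v y - a *\<^sub>R outer (axis i 1)) *v k)) (at y)"
  proof -
    have "(DW has_derivative (\<lambda>k. Hess S u y *v k - Hess S v y *v k - \<epsilon> *\<^sub>R (((\<alpha>\<^sup>2 * h y) *\<^sub>R outer (axis i 1)) *v k))) (at y)"
      unfolding DW_def h_def
      by (intro has_derivative_diff has_derivative_scaleR_right derivs_at u_C2 v_C2 y\<Omega> exp_barrier_derivs)
    then show ?thesis
      by (simp add: a_def matrix_vector_mult_diff_rdistrib scaleR_matrix_vector_assoc[symmetric])
  qed
  have min: "W y \<le> W z" if "z \<in> ball y d" for z
    using that d(2) closure_subset by (intro y(2)) blast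
  have "DW y = 0" and psd: "psd (Hess S u y - Hess S v y - a *\<^sub>R outer (axis i 1))"
    using local_min_second_order[OF d(1) W' DW' min] by auto
  then have "Grad S u y - Grad S v y = (\<epsilon> * \<alpha> * h y) *\<^sub>R axis i 1" by (simp add: DW_def)
  then have e: "norm (Grad S u y - Grad S v y) = \<epsilon> * \<alpha> * h y"
    using \<epsilon>(1) \<open>0 < \<alpha>\<close> hpos[of y] by (simp add: norm_axis_1)
  have b: "\<bar>v y\<bar> \<le> r" "norm (Grad S u y) \<le> r" "norm (Grad S v y) \<le> r"
    using r y(1) by (auto simp: r_def le_max_iff_disj)
  have "a * \<theta> \<le> (2 * C + 1) * L * (\<epsilon> * \<alpha> * h y)"
  proof (rule perturbation_bound[OF y\<Omega> neg _ \<theta>C(2) psd \<theta>C(3,4)])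
    have le: "l * norm (Grad S u y - Grad S v y) \<le> L * (\<epsilon> * \<alpha> * h y)" if "l \<le> L" for l
      unfolding e using that \<epsilon>(1) \<open>0 < \<alpha>\<close> hpos[of y] by (intro mult_right_mono) auto
    show "norm (A y (v y) (Grad S u y) - A y (v y) (Grad S v y)) \<le> L * (\<epsilon> * \<alpha> * h y)"
      by (rule order_trans[OF LA(2)[OF y(1) b] le]) (simp add: L_def)
    show "norm (B y (v y) (Grad S u y) - B y (v y) (Grad S v y)) \<le> L * (\<epsilon> * \<alpha> * h y)"
      by (rule order_trans[OF LB(2)[OF y(1) b] le]) (simp add: L_def)
    show "\<bar>ln (f y (v y) (Grad S u y)) - ln (f y (v y) (Grad S v y))\<bar> \<le> L * (\<epsilon> * \<alpha> * h y)"
      using order_trans[OF Lf(2)[OF y(1) b] le] by (simp add: L_def)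
    show "norm (R_op \<Omega> A B u y) \<le> \<Lambda>" "norm (R_op \<Omega> A B v y) \<le> \<Lambda>"
      using \<Lambda> y(1) by (auto simp: \<Lambda>_def le_max_iff_disj)
    show "0 \<le> a" using \<epsilon>(1) hpos[of y] by (simp add: a_def)
  qed
  moreover have "a * \<theta> = (\<alpha> * \<theta>) * (\<epsilon> * \<alpha> * h y)" by (simp add: a_def power2_eq_square)
  ultimately have "(\<alpha> * \<theta>) * (\<epsilon> * \<alpha> * h y) \<le> ((2 * C + 1) * L) * (\<epsilon> * \<alpha> * h y)" by simp
  moreover have "0 < \<epsilon> * \<alpha> * h y" using \<epsilon>(1) \<open>0 < \<alpha>\<close> hpos[of y] by simp
  \<comment> \<open>Both sides carry the factor \<epsilon> \<alpha> h(y), so neither \<epsilon> nor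
    the location of y affects the contradiction.\<close>
  ultimately have "\<alpha> * \<theta> \<le> (2 * C + 1) * L" by (rule mult_right_le_imp_le)
  then show False using \<theta>C(1) by (simp add: \<alpha>_def)
qed

lemma normal_derivative_comparison:
  assumes smooth: "smooth_bounded_domain \<Omega>"
    and bd: "\<And>x. x \<in> frontier \<Omega> \<Longrightarrow> u x = v x" and x: "x \<in> frontier \<Omega>"
  shows "Grad S v x \<bullet> inner_normal \<Omega> x \<le> Grad S u x \<bullet> inner_normal \<Omega> x"
proof -
  obtain d where d: "0 < d" "\<And>t. 0 < t \<Longrightarrow> t < d \<Longrightarrow> x + t *\<^sub>R inner_normal \<Omega> x \<in> \<Omega>"
    using inner_normal_points_inward[OF smooth x] by blast
  have xS: "x \<in> S" using x by (simp add: frontier_def)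
  have "((\<lambda>y. u y - v y) has_derivative (\<lambda>h. Grad S u x \<bullet> h - Grad S v x \<bullet> h)) (at x within S)"
    using C2_on_derivs[OF u_C2] C2_on_derivs[OF v_C2] xS
    by (intro has_derivative_diff) (auto simp: is_C2_derivs_def)
  then have "((\<lambda>y. u y - v y) has_derivative (\<lambda>h. (Grad S u x - Grad S v x) \<bullet> h)) (at x within S)"
    by (simp add: inner_diff_left)
  then have "0 \<le> (Grad S u x - Grad S v x) \<bullet> inner_normal \<Omega> x"
  proof (rule inward_derivative_nonneg[OF _ d(1)])
    fix t assume t: "0 < t" "t < d"
    have "v y \<le> u y" if "y \<in> \<Omega>" for y by (rule comparison) (use bd that in auto)
    then show "x + t *\<^sub>R inner_normal \<Omega> x \<in> S \<and>
        u x - v x \<le> u (x + t *\<^sub>R inner_normal \<Omega> x) - v (x + t *\<^sub>R inner_normal \<Omega> x)"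
      using d(2)[OF t] bd[OF x] closure_subset[of \<Omega>] by auto
  qed
  then show ?thesis by (simp add: inner_diff_left)
qed

end

theorem theorem2p2:
  fixes \<Omega> :: "(real^'n) set"
    and A B :: "real^'n \<Rightarrow> real \<Rightarrow> real^'n \<Rightarrow> real^'n^'n"
    and f :: "real^'n \<Rightarrow> real \<Rightarrow> real^'n \<Rightarrow> real"
    and u v :: "real^'n \<Rightarrow> real"
    and k :: nat and \<delta> \<beta>\<^sub>1 :: real
  assumes k: "2 \<le> k" "k \<le> CARD('n)"
    and dom: "smooth_bounded_domain \<Omega>"
    and A_C1: "C1_on (dom_D \<Omega>) (\<lambda>(x, z, p). A x z p)"
    and A_sym: "\<forall>(x, z, p)\<in>dom_D \<Omega>. symmetric_mat (A x z p)"
    and f_C1: "C1_on (dom_D \<Omega>) (\<lambda>(x, z, p). f x z p)"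
    and B_BC1: "BC1_on (dom_D \<Omega>) (\<lambda>(x, z, p). B x z p)"
    and B_skew: "\<forall>(x, z, p)\<in>dom_D \<Omega>. skew_mat (B x z p)"
    and \<delta>: "0 < \<delta>" "\<delta> < 1"
    and u_C2: "C2_on (closure \<Omega>) u"
    and v_C2: "C2_on (closure \<Omega>) v"
    and i: "\<forall>x\<in>\<Omega>. G_k k \<Omega> A B f u x \<le> G_k k \<Omega> A B f v x"
    and ii: "lambda_fun \<Omega> A u > 0" "lambda_fun \<Omega> A v > 0"
    and iii: "\<forall>(x, z, p)\<in>dom_D \<Omega>. psd (Dz A x z p)"
    and iv: "mu \<Omega> B \<le> \<delta> * min (lambda_fun \<Omega> A u) (lambda_fun \<Omega> A v)"
    and v: "\<beta>\<^sub>1 > 0" "mu \<Omega> (Dz B) \<le> \<beta>\<^sub>1 * min (lambda_fun \<Omega> A u) (lambda_fun \<Omega> A v)"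
    and vi: "\<forall>(x, z, p)\<in>dom_D \<Omega>. f x z p > 0"
    and vii: "\<forall>(x, z, p)\<in>dom_D \<Omega>. Dz f x z p / f x z p \<ge> k * \<delta> / (1 + \<delta>\<^sup>2) * \<beta>\<^sub>1"
  shows "((\<forall>x\<in>frontier \<Omega>. u x \<ge> v x) \<longrightarrow> (\<forall>x\<in>\<Omega>. u x \<ge> v x)) \<and>
         ((\<forall>x\<in>frontier \<Omega>. u x = v x) \<longrightarrow>
            (\<forall>x\<in>frontier \<Omega>. Grad (closure \<Omega>) u x \<bullet> inner_normal \<Omega> x
                            \<ge> Grad (closure \<Omega>) v x \<bullet> inner_normal \<Omega> x))"
proof -
  note smooth = dom
  interpret hessian_comparison \<Omega> A B f u v k \<delta> \<beta>\<^sub>1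
  proof
    show "1 \<le> k" "k \<le> CARD('n)" using k by auto
    show "open \<Omega>" "bounded \<Omega>" using dom by (auto simp: smooth_bounded_domain_def)
  qed (use assms in \<open>auto simp: dom_D_def\<close>)
  show ?thesis using comparison normal_derivative_comparison[OF smooth] by blast
qed

end
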